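(* Let $\mathrm A:(0,\infty)\to\mathbb R$ be continuous with $\int_0^\infty u\,\mathrm A(u)^2\,du\le 1$. Then $$W(u,v)=\int_0^\infty \mathrm A(u+t)\mathrm A(t+v)\,dt$$ is the kernel of a trace-class operator $W$ on $L^2(0,\infty)$, and for every complex $\kappa$ with $|\kappa|<1$ the Marchenko integral equation $$K(x,z)-\kappa^2\int_x^\infty K(x,y)W(y,z)\,dy=\kappa W(x,z)$$ has a solution $K(x,z)$ which is a trace-class kernel, and it satisfies $$\frac{\partial}{\partial x}\log\det\big(I-\kappa^2P_{(x,\infty)}WP_{(x,\infty)}\big)=\kappa K(x,x)\qquad(x>0).$$
   Context: $P_{(x,\infty)}$ denotes multiplication by the indicator function of $(x,\infty)$; $\det$ denotes the Fredholm determinant of $I$ plus a trace-class operator. *)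

theory Defs
  imports "HOL-Analysis.Analysis"
begin

definition L2_pos :: "(real \<Rightarrow> complex) \<Rightarrow> bool" where
  "L2_pos f \<longleftrightarrow> set_borel_measurable lborel {0<..} f \<and>
     set_integrable lborel {0<..} (\<lambda>x. (cmod (f x))^2)"

definition L2_norm_pos :: "(real \<Rightarrow> complex) \<Rightarrow> real" where
  "L2_norm_pos f = sqrt (LINT x:{0<..}|lborel. (cmod (f x))^2)"

text \<open>A kernel K on (0,\<infinity>)x(0,\<infinity>) is the kernel of a trace-class (= nuclear) operator
  on L2(0,\<infinity>): K(x,y) = sum_n a_n(x) b_n(y) almost everywhere, with a_n, b_n in L2 and
  sum_n ||a_n|| ||b_n|| finite.\<close>
definition trace_class_kernel :: "(real \<Rightarrow> real \<Rightarrow> complex) \<Rightarrow> bool" where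
  "trace_class_kernel K \<longleftrightarrow>
     (\<exists>a b :: nat \<Rightarrow> real \<Rightarrow> complex.
        (\<forall>n. L2_pos (a n) \<and> L2_pos (b n)) \<and>
        summable (\<lambda>n. L2_norm_pos (a n) * L2_norm_pos (b n)) \<and>
        (AE p in lborel. p \<in> {0<..} \<times> {0<..} \<longrightarrow>
            (\<lambda>n. a n (fst p) * b n (snd p)) sums K (fst p) (snd p)))"

definition fred_minor :: "(real \<Rightarrow> real \<Rightarrow> complex) \<Rightarrow> nat \<Rightarrow> (nat \<Rightarrow> real) \<Rightarrow> complex" where
  "fred_minor G n xs =
     (\<Sum>\<sigma>\<in>{\<sigma>. \<sigma> permutes {..<n}}. of_int (sign \<sigma>) * (\<Prod>i<n. G (xs i) (xs (\<sigma> i))))"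

text \<open>Fredholm determinant det(I + T) of the operator T on L2(0,\<infinity>) with kernel G,
  given by Fredholm's series.\<close>
definition fredholm_det :: "(real \<Rightarrow> real \<Rightarrow> complex) \<Rightarrow> complex" where
  "fredholm_det G =
     (\<Sum>n. (LINT xs | PiM {..<n} (\<lambda>_. restrict_space lborel {0<..}). fred_minor G n xs)
            / of_nat (fact n))"

end

theory Submission
  imports Defs
begin

text \<open>Put \<open>w u = W u u\<close>, the integral of \<open>A\<^sup>2\<close> over \<open>(u, \<infinity>)\<close>. Cauchy--Schwarz gives
  \<open>\<bar>W u v\<bar> \<le> sqrt (w u * w v)\<close>, and the integral of \<open>w\<close> equals that of \<open>u * A(u)\<^sup>2\<close>, hence is at most 1.
  So every Neumann series in \<open>\<kappa>\<^sup>2\<close> converges pointwise and geometrically, no operator theory being needed.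
  Expanding the Fredholm minors along the cycle through one index yields Newton's identities, hence
  \<open>det = exp (- \<Sum>k. \<kappa>\<^sup>2\<^sup>k tr (W\<^sub>x\<^sup>k) / k)\<close> with \<open>W\<^sub>x\<close> the compression of \<open>W\<close> to \<open>(x, \<infinity>)\<close>. Splitting the
  integrals along the diagonal shows that \<open>tr (W\<^sub>x\<^sup>k) / k\<close> is the integral over \<open>t > x\<close> of the kernel of
  \<open>W\<^sub>t\<^sup>k\<close> at \<open>(t, t)\<close>; summing up, \<open>det = exp (- \<integral> \<kappa> K(t, t) dt)\<close> over \<open>t > x\<close>.
  For the trace class property, the Haar coefficients \<open>a\<^sub>n(u)\<close> of \<open>A(u + \<cdot>)\<close> give
  \<open>W u v = (\<Sum>n. a\<^sub>n u * a\<^sub>n v)\<close> by Parseval, and the Marchenko equation turns this into an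
  expansion of \<open>K\<close>.\<close>

text \<open>The value \<open>K x x\<close> lives on the diagonal, a null set, about which identities
  holding almost everywhere say nothing. All kernels are therefore concrete functions, and the
  identities for iterated kernels, the Marchenko equation and the expansions are proved at every
  point. One bound by \<open>g u * g v\<close> carries the estimates: each variable integrated out
  contributes \<open>(g y)\<^sup>2\<close>, of total mass at most 1, so the bound is the same for
  all powers of the operator, and |\<kappa>| < 1 is just what the geometric series asks for.
  Differentiation under iterated integrals is avoided by stating derivatives in the left endpoint in
  integrated form, from the endpoint to infinity, where Fubini's theorem suffices; the only genuine
  differentiation is that of a single integral with continuous integrand. Continuity of
  \<open>A\<close> thus serves twice: for that derivative, and for the convergence of dyadic
  averages at every point, which stands in for Lebesgue's differentiation theorem in the
  completeness of the Haar system.\<close>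

lemma norm_integral_le_dominated:
  fixes f :: "'a \<Rightarrow> 'b::{banach,second_countable_topology}"
  assumes g: "integrable M g" and le: "\<And>x. norm (f x) \<le> g x"
  shows "norm (LINT x|M. f x) \<le> (LINT x|M. g x)"
proof (cases "integrable M f")
  case True
  have "norm (LINT x|M. f x) \<le> (LINT x|M. norm (f x))" by (rule integral_norm_bound)
  also have "\<dots> \<le> (LINT x|M. g x)" using True g le by (intro integral_mono) auto
  finally show ?thesis .
next
  case False
  \<comment> \<open>If \<open>f\<close> has no integral, its integral is 0 by convention, and a
    nonnegative right-hand side is enough. Estimates drawn from this rule thus leave no
    measurability goals for \<open>f\<close>.\<close>
  have "0 \<le> (LINT x|M. g x)" using norm_ge_zero le by (intro Bochner_Integration.integral_nonneg) (rule order_trans)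
  then show ?thesis using False by (simp add: not_integrable_integral_eq)
qed

lemma integrable_mult_of_square_integrable:
  fixes f h :: "'a \<Rightarrow> real"
  assumes [measurable]: "f \<in> borel_measurable M" "h \<in> borel_measurable M"
    and f: "integrable M (\<lambda>x. (f x)\<^sup>2)" and h: "integrable M (\<lambda>x. (h x)\<^sup>2)"
  shows "integrable M (\<lambda>x. f x * h x)"
proof (rule Bochner_Integration.integrable_bound[OF Bochner_Integration.integrable_add[OF f h]])
  show "AE x in M. norm (f x * h x) \<le> norm ((f x)\<^sup>2 + (h x)\<^sup>2)"
  proof (intro always_eventually allI)
    fix x
    have "0 \<le> (\<bar>f x\<bar> - \<bar>h x\<bar>)\<^sup>2" by simp
    then have "2 * (\<bar>f x\<bar> * \<bar>h x\<bar>) \<le> (f x)\<^sup>2 + (h x)\<^sup>2" by (simp add: power2_diff)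
    moreover have "0 \<le> \<bar>f x\<bar> * \<bar>h x\<bar>" by simp
    ultimately have "\<bar>f x\<bar> * \<bar>h x\<bar> \<le> (f x)\<^sup>2 + (h x)\<^sup>2" by linarith
    then show "norm (f x * h x) \<le> norm ((f x)\<^sup>2 + (h x)\<^sup>2)"
      by (simp add: abs_mult)
  qed
qed measurable

lemma Cauchy_Schwarz_integral:
  fixes f h :: "'a \<Rightarrow> real"
  assumes [measurable]: "f \<in> borel_measurable M" "h \<in> borel_measurable M"
    and f: "integrable M (\<lambda>x. (f x)\<^sup>2)" and h: "integrable M (\<lambda>x. (h x)\<^sup>2)"
  shows "\<bar>LINT x|M. f x * h x\<bar> \<le> sqrt (LINT x|M. (f x)\<^sup>2) * sqrt (LINT x|M. (h x)\<^sup>2)"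
proof -
  define a where "a = (LINT x|M. (f x)\<^sup>2)"
  define b where "b = (LINT x|M. f x * h x)"
  define c where "c = (LINT x|M. (h x)\<^sup>2)"
  have c0: "0 \<le> c" unfolding c_def by simp
  have fh: "integrable M (\<lambda>x. f x * h x)" by (rule integrable_mult_of_square_integrable) (use f h in auto)
  \<comment> \<open>Integrating \<open>(f - l * h)\<^sup>2\<close> gives a quadratic in
    \<open>l\<close> without negative values; its value at \<open>l = b / c\<close> is the
    claim.\<close>
  have quad: "0 \<le> a - 2 * l * b + l\<^sup>2 * c" for l
  proof -
    have "0 \<le> (LINT x|M. (f x - l * h x)\<^sup>2)" by simp
    also have "\<dots> = (LINT x|M. (f x)\<^sup>2 - (2 * l) * (f x * h x) + l\<^sup>2 * (h x)\<^sup>2)"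
      by (intro Bochner_Integration.integral_cong) (auto simp: power2_eq_square algebra_simps)
    also have "\<dots> = a - 2 * l * b + l\<^sup>2 * c"
      unfolding a_def b_def c_def using f h fh by simp
    finally show ?thesis .
  qed
  have "b\<^sup>2 \<le> a * c"
  proof (cases "c = 0")
    case True
    have "b = 0"
    proof (rule ccontr)
      assume "b \<noteq> 0"
      \<comment> \<open>For \<open>c = 0\<close> the quadratic is affine in \<open>l\<close>, and
        this \<open>l\<close> gives it the value -1.\<close>
      then show False using quad[of "(a + 1) / (2 * b)"] True by (simp add: field_simps)
    qed
    then show ?thesis using True by simp
  next
    case False
    then show ?thesis using quad[of "b / c"] c0 by (simp add: field_simps power2_eq_square)
  qed
  then have "sqrt (b\<^sup>2) \<le> sqrt (a * c)" by (rule real_sqrt_le_mono)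
  then show ?thesis unfolding a_def b_def c_def by (simp add: real_sqrt_mult)
qed

text \<open>The recursion is the coefficient form of F' = L' F, where F has the coefficients
  \<open>d n\<close> and L, the logarithm of F, has \<open>(-1)^k * T k / (k + 1)\<close> at
  z^(k+1). The bound on \<open>T\<close> makes both series converge beyond the unit disc, so z = 1
  may be inserted in F = exp L.\<close>

lemma newton_identities_sums_exp:
  fixes T d :: "nat \<Rightarrow> complex"
  assumes d0: "d 0 = 1"
    and newton: "\<And>n. of_nat (Suc n) * d (Suc n) = (\<Sum>j\<le>n. (-1)^j * T j * d (n - j))"
    and q: "0 \<le> q" "q < 1"
    and T: "\<And>k. norm (T k) \<le> q ^ Suc k"
  shows "d sums exp (\<Sum>k. (-1)^k * T k / of_nat (Suc k))"
proof -
  have d: "norm (d n) \<le> q ^ n" for n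
  proof (induction n rule: less_induct)
    case (less n)
    show ?case
    proof (cases n)
      case 0
      then show ?thesis using d0 by simp
    next
      case (Suc m)
      \<comment> \<open>There are \<open>Suc m\<close> summands, each at most
        \<open>q ^ Suc m\<close>; their number cancels the factor on the left.\<close>
      have "of_nat (Suc m) * norm (d (Suc m)) = norm (\<Sum>j\<le>m. (-1)^j * T j * d (m - j))"
        unfolding newton[symmetric] norm_mult norm_of_nat ..
      also have "\<dots> \<le> (\<Sum>j\<le>m. q ^ Suc j * q ^ (m - j))"
        using less Suc T q
        by (intro sum_norm_le) (auto simp: norm_mult norm_power intro!: mult_mono simp del: power_Suc)
      also have "\<dots> = (\<Sum>j\<le>m. q ^ Suc m)"
        by (intro sum.cong refl) (auto simp flip: power_add)
      also have "\<dots> = of_nat (Suc m) * q ^ Suc m" by simp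
      finally show ?thesis using Suc by (simp del: power_Suc of_nat_Suc)
    qed
  qed
  \<comment> \<open>Any number strictly between \<open>q\<close> and 1 does: series with
    coefficients bounded by \<open>q ^ n\<close> still converge at 1 / r > 1.\<close>
  define r where "r = (q + 1) / 2"
  have r: "q < r" "0 < r" "r < 1" using q by (auto simp: r_def)
  have radius: "conv_radius f > 1" if f: "\<And>n. norm (f n) \<le> q ^ n" for f :: "nat \<Rightarrow> complex"
  proof -
    have "summable (\<lambda>n. f n * of_real (1 / r) ^ n)"
    proof (rule summable_comparison_test')
      show "summable (\<lambda>n. (q / r) ^ n)" using q r by (intro summable_geometric) auto
      show "norm (f n * of_real (1 / r) ^ n) \<le> (q / r) ^ n" if "n \<ge> 0" for n
        using f[of n] r by (simp add: norm_mult norm_power power_divide divide_right_mono norm_divide)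
    qed
    then have "conv_radius f \<ge> norm (of_real (1 / r) :: complex)" by (rule conv_radius_geI)
    moreover have "ereal (norm (of_real (1 / r) :: complex)) > 1" using r by (simp add: norm_divide)
    ultimately show ?thesis by (rule less_le_trans[rotated])
  qed
  define F where "F = Abs_fps d"
  define L where "L = Abs_fps (\<lambda>n. if n = 0 then 0 else (-1)^(n-1) * T (n-1) / of_nat n)"
  have RF: "fps_conv_radius F > 1" unfolding fps_conv_radius_def F_def by (simp add: radius d)
  have "norm (if n = 0 then 0 else (-1)^(n-1) * T (n-1) / of_nat n) \<le> q ^ n" for n
  proof (cases n)
    case (Suc m)
    have "norm (T m) / real (Suc m) \<le> norm (T m) / 1" by (intro divide_left_mono) auto
    also have "\<dots> \<le> q ^ Suc m" using T[of m] by simp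
    finally show ?thesis using Suc
      by (simp add: norm_mult norm_power norm_divide del: power_Suc of_nat_Suc)
  qed (auto simp: q)
  then have RL: "fps_conv_radius L > 1" unfolding fps_conv_radius_def L_def
    by (simp add: radius)
  have ode: "fps_deriv F = fps_deriv L * F"
    by (rule fps_ext) (auto simp: F_def L_def fps_mult_nth newton atLeast0AtMost simp del: of_nat_Suc intro!: sum.cong)
  have RL': "fps_conv_radius (fps_deriv L) > 1" using RL fps_conv_radius_deriv[of L] by (rule less_le_trans)
  have inR: "ereal (norm z) < fps_conv_radius H" if "z \<in> cball 0 1" "fps_conv_radius H > 1" for H and z :: complex
    using that by (metis dist_0_norm ereal_less_eq(3) le_less_trans mem_cball one_ereal_def)
  \<comment> \<open>By the differential equation \<open>h\<close> has derivative 0 on the disc, and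
    comparing its values at 0 and 1 evaluates F at 1.\<close>
  define h where "h z = eval_fps F z * exp (- eval_fps L z)" for z
  have "\<exists>c. \<forall>z\<in>cball 0 1. h z = c"
  proof (rule has_field_derivative_zero_constant)
    fix z :: complex assume z: "z \<in> cball 0 1"
    have "eval_fps (fps_deriv F) z = eval_fps (fps_deriv L) z * eval_fps F z"
      unfolding ode by (intro eval_fps_mult inR z RF RL')
    then show "(h has_field_derivative 0) (at z within cball 0 1)"
      unfolding h_def
      by (auto intro!: derivative_eq_intros has_field_derivative_eval_fps inR z RF RL simp: algebra_simps)
  qed auto
  then obtain c where c: "\<And>z. z \<in> cball 0 1 \<Longrightarrow> h z = c" by blast
  have "h 1 = h 0" using c[of 0] c[of 1] by simp
  also have "h 0 = 1" by (simp add: h_def eval_fps_at_0 F_def L_def d0)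
  finally have F1: "eval_fps F 1 = exp (eval_fps L 1)"
    by (simp add: h_def exp_minus field_simps)
  have "(\<lambda>n. fps_nth L n) sums eval_fps L 1"
    using sums_eval_fps[of 1 L] inR[of 1 L] RL by simp
  moreover have "fps_nth L 0 = 0" by (simp add: L_def)
  ultimately have "(\<lambda>n. fps_nth L (Suc n)) sums eval_fps L 1"
    using sums_Suc_iff[of "fps_nth L" "eval_fps L 1"] by simp
  then have L1: "(\<Sum>k. (-1)^k * T k / of_nat (Suc k)) = eval_fps L 1"
    by (simp add: L_def sums_iff del: of_nat_Suc)
  have "(\<lambda>n. fps_nth F n) sums eval_fps F 1"
    using sums_eval_fps[of 1 F] inR[of 1 F] RF by simp
  then show ?thesis unfolding L1 F1[symmetric] by (simp add: F_def)
qed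

section \<open>Fredholm determinants and Newton identities\<close>

text \<open>In a product of kernel values along a permutation every variable occurs once as first
  and once as second argument. A bound of the form \<open>g u * g v\<close> therefore dominates it
  by the product of all \<open>(g (x i))\<^sup>2\<close>, which is integrable; this takes the place
  of Hadamard's inequality.\<close>

locale dominated_kernel = sigma_finite_measure M for M :: "'a measure" +
  fixes G :: "'a \<Rightarrow> 'a \<Rightarrow> complex" and g :: "'a \<Rightarrow> real"
  assumes kernel_measurable [measurable]: "(\<lambda>(u, v). G u v) \<in> borel_measurable (M \<Otimes>\<^sub>M M)"
    and weight_measurable [measurable]: "g \<in> borel_measurable M"
    and weight_nonneg: "0 \<le> g u"
    and weight_integrable: "integrable M (\<lambda>u. (g u)\<^sup>2)"
    and kernel_le: "norm (G u v) \<le> g u * g v"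
begin

sublocale product_sigma_finite "\<lambda>_. M"
  by unfold_locales

definition mass :: real where "mass = (LINT u|M. (g u)\<^sup>2)"

text \<open>The index is shifted by one: \<open>kpow k\<close> is the kernel of the power k + 1 of
  the operator, and \<open>ktrace k\<close> below is the trace of that power.\<close>

primrec kpow :: "nat \<Rightarrow> 'a \<Rightarrow> 'a \<Rightarrow> complex" where
  "kpow 0 u v = G u v"
| "kpow (Suc k) u v = (LINT y|M. G u y * kpow k y v)"

definition ktrace :: "nat \<Rightarrow> complex" where
  "ktrace k = (LINT y|M. kpow k y y)"

definition minor_term :: "'i set \<Rightarrow> ('i \<Rightarrow> 'i) \<Rightarrow> ('i \<Rightarrow> 'a) \<Rightarrow> complex" where
  "minor_term I p x = (\<Prod>i\<in>I. G (x i) (x (p i)))"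

text \<open>A minor term in which the factor leaving \<open>c\<close> carries the power k + 1 of the
  kernel: it records that \<open>k\<close> further variables of the cycle through \<open>c\<close>
  have been integrated out.\<close>

definition marked_term :: "'i set \<Rightarrow> 'i \<Rightarrow> nat \<Rightarrow> ('i \<Rightarrow> 'i) \<Rightarrow> ('i \<Rightarrow> 'a) \<Rightarrow> complex" where
  "marked_term I c k p x = kpow k (x c) (x (p c)) * minor_term (I - {c}) p x"

text \<open>The integrated determinant of the matrix \<open>G (x i) (x j)\<close>. General finite
  index sets, rather than initial segments, allow any index to be removed.\<close>

definition minor_integral :: "'i set \<Rightarrow> complex" where
  "minor_integral I =
     (\<Sum>p | p permutes I. of_int (sign p) * (LINT x|PiM I (\<lambda>_. M). minor_term I p x))"

definition marked_integral :: "'i set \<Rightarrow> 'i \<Rightarrow> nat \<Rightarrow> complex" where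
  "marked_integral I c k =
     (\<Sum>p | p permutes I. of_int (sign p) * (LINT x|PiM I (\<lambda>_. M). marked_term I c k p x))"

lemma mass_nonneg: "0 \<le> mass"
  unfolding mass_def by (rule integral_nonneg_AE) auto

lemma kpow_measurable [measurable]: "(\<lambda>(u, v). kpow k u v) \<in> borel_measurable (M \<Otimes>\<^sub>M M)"
proof (induction k)
  case 0
  then show ?case using kernel_measurable by simp
next
  case (Suc k)
  note [measurable] = Suc
  show ?case by simp
qed

lemma kpow_le: "norm (kpow k u v) \<le> mass ^ k * (g u * g v)"
proof (induction k arbitrary: u v)
  case 0
  then show ?case using kernel_le by simp
next
  case (Suc k)
  have "norm (G u y * kpow k y v) \<le> (g u * g v * mass ^ k) * (g y)\<^sup>2" for y
  proof -
    have "norm (G u y * kpow k y v) \<le> (g u * g y) * (mass ^ k * (g y * g v))"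
      unfolding norm_mult by (intro mult_mono kernel_le Suc) (auto simp: weight_nonneg)
    then show ?thesis by (simp add: algebra_simps power2_eq_square)
  qed
  then have "norm (kpow (Suc k) u v) \<le> (LINT y|M. (g u * g v * mass ^ k) * (g y)\<^sup>2)"
    unfolding kpow.simps by (intro norm_integral_le_dominated) (auto intro!: integrable_mult_right weight_integrable)
  then show ?case by (simp add: mass_def[symmetric] algebra_simps)
qed

lemma ktrace_le: "norm (ktrace k) \<le> mass ^ Suc k"
proof -
  have "norm (ktrace k) \<le> (LINT y|M. mass ^ k * (g y)\<^sup>2)"
    unfolding ktrace_def
    using kpow_le[of k] by (intro norm_integral_le_dominated integrable_mult_right weight_integrable) (auto simp: power2_eq_square)
  then show ?thesis by (simp add: mass_def mult.commute)
qed

lemma minor_term_integrable: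
  assumes "finite I" "p permutes I"
  shows "integrable (PiM I (\<lambda>_. M)) (minor_term I p)"
proof (rule Bochner_Integration.integrable_bound)
  show "integrable (PiM I (\<lambda>_. M)) (\<lambda>x. \<Prod>i\<in>I. (g (x i))\<^sup>2)"
    using assms(1) by (intro product_integrable_prod weight_integrable)
  show "minor_term I p \<in> borel_measurable (PiM I (\<lambda>_. M))"
    unfolding minor_term_def
  proof (intro borel_measurable_prod)
    fix i assume "i \<in> I"
    then have [measurable]: "(\<lambda>x. x i) \<in> measurable (PiM I (\<lambda>_. M)) M" "(\<lambda>x. x (p i)) \<in> measurable (PiM I (\<lambda>_. M)) M"
      using assms(2) by (auto intro!: measurable_component_singleton simp: permutes_in_image)
    show "(\<lambda>x. G (x i) (x (p i))) \<in> borel_measurable (PiM I (\<lambda>_. M))" by measurable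
  qed
  have "norm (minor_term I p x) \<le> norm (\<Prod>i\<in>I. (g (x i))\<^sup>2)" for x
  proof -
    have "norm (minor_term I p x) \<le> (\<Prod>i\<in>I. g (x i) * g (x (p i)))"
      unfolding minor_term_def prod_norm[symmetric] by (intro prod_mono) (auto intro: kernel_le)
    also have "\<dots> = (\<Prod>i\<in>I. g (x i)) * (\<Prod>i\<in>I. g (x (p i)))" by (rule prod.distrib)
    also have "(\<Prod>i\<in>I. g (x (p i))) = (\<Prod>i\<in>I. g (x i))"
      by (rule prod.permute[OF assms(2), of "\<lambda>i. g (x i)", symmetric, unfolded comp_def])
    also have "(\<Prod>i\<in>I. g (x i)) * (\<Prod>i\<in>I. g (x i)) = (\<Prod>i\<in>I. (g (x i))\<^sup>2)"
      by (simp add: prod.distrib power2_eq_square)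
    finally show ?thesis by simp
  qed
  then show "AE x in PiM I (\<lambda>_. M). norm (minor_term I p x) \<le> norm (\<Prod>i\<in>I. (g (x i))\<^sup>2)" by simp
qed

lemma marked_term_integrable:
  assumes "finite I" "p permutes I" "c \<in> I"
  shows "integrable (PiM I (\<lambda>_. M)) (marked_term I c k p)"
proof (rule Bochner_Integration.integrable_bound)
  show "integrable (PiM I (\<lambda>_. M)) (\<lambda>x. mass ^ k * (\<Prod>i\<in>I. (g (x i))\<^sup>2))"
    using assms(1) by (intro integrable_mult_right product_integrable_prod weight_integrable)
  have comp: "(\<lambda>x. x i) \<in> measurable (PiM I (\<lambda>_. M)) M" "(\<lambda>x. x (p i)) \<in> measurable (PiM I (\<lambda>_. M)) M" if "i \<in> I" for i
      using assms(2) that by (auto intro!: measurable_component_singleton simp: permutes_in_image)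
  note [measurable] = comp[OF assms(3)]
  have "(\<lambda>x. G (x i) (x (p i))) \<in> borel_measurable (PiM I (\<lambda>_. M))" if "i \<in> I - {c}" for i
  proof -
    from that have "i \<in> I" by simp
    note [measurable] = comp[OF this]
    show ?thesis by measurable
  qed
  then have [measurable]: "minor_term (I - {c}) p \<in> borel_measurable (PiM I (\<lambda>_. M))"
    unfolding minor_term_def by (intro borel_measurable_prod)
  show "marked_term I c k p \<in> borel_measurable (PiM I (\<lambda>_. M))"
    unfolding marked_term_def by measurable
  have "norm (marked_term I c k p x) \<le> norm (mass ^ k * (\<Prod>i\<in>I. (g (x i))\<^sup>2))" for x
  proof -
    have "norm (marked_term I c k p x) \<le> (mass ^ k * (g (x c) * g (x (p c)))) * (\<Prod>i\<in>I-{c}. g (x i) * g (x (p i)))"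
      unfolding marked_term_def norm_mult minor_term_def prod_norm[symmetric]
      by (intro mult_mono prod_mono) (auto intro: kernel_le kpow_le prod_nonneg simp: mass_nonneg weight_nonneg)
    also have "\<dots> = mass ^ k * (\<Prod>i\<in>I. g (x i) * g (x (p i)))"
      using prod.remove[OF assms(1,3), of "\<lambda>i. g (x i) * g (x (p i))"] by simp
    also have "\<dots> = mass ^ k * ((\<Prod>i\<in>I. g (x i)) * (\<Prod>i\<in>I. g (x (p i))))" by (simp add: prod.distrib)
    also have "(\<Prod>i\<in>I. g (x (p i))) = (\<Prod>i\<in>I. g (x i))"
      by (rule prod.permute[OF assms(2), of "\<lambda>i. g (x i)", symmetric, unfolded comp_def])
    also have "(\<Prod>i\<in>I. g (x i)) * (\<Prod>i\<in>I. g (x i)) = (\<Prod>i\<in>I. (g (x i))\<^sup>2)"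
      by (simp add: prod.distrib power2_eq_square)
    finally show ?thesis by (simp add: mass_nonneg)
  qed
  then show "AE x in PiM I (\<lambda>_. M). norm (marked_term I c k p x) \<le> norm (mass ^ k * (\<Prod>i\<in>I. (g (x i))\<^sup>2))" by simp
qed

lemma minor_integral_eq_marked:
  assumes "finite I" "c \<in> I"
  shows "minor_integral I = marked_integral I c 0"
  unfolding minor_integral_def marked_integral_def marked_term_def minor_term_def kpow.simps
  by (intro sum.cong refl arg_cong2[where f = "(*)"] Bochner_Integration.integral_cong prod.remove assms)

lemma minor_term_cong:
  assumes "\<And>i. i \<in> J \<Longrightarrow> p i = p' i \<and> x i = y i \<and> x (p i) = y (p i)"
  shows "minor_term J p x = minor_term J p' y"
  unfolding minor_term_def by (rule prod.cong[OF refl]) (metis assms)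

text \<open>If \<open>c\<close> is a fixed point its factor integrates to a trace; otherwise integrating out the
  variable of \<open>c\<close> merges the two factors next to \<open>c\<close> in its cycle.\<close>

lemma integral_marked_term_fixed:
  assumes J: "finite J" "c \<notin> J" and q: "q permutes J"
  shows "(LINT x|PiM (insert c J) (\<lambda>_. M). marked_term (insert c J) c k q x)
       = ktrace k * (LINT x|PiM J (\<lambda>_. M). minor_term J q x)"
proof -
  have q': "q permutes insert c J" using q by (rule permutes_subset) auto
  have qc: "q c = c" using q J by (simp add: permutes_not_in)
  have "marked_term (insert c J) c k q (x(c := y)) = kpow k y y * minor_term J q x" for x y
  proof -
    have "insert c J - {c} = J" using J by auto
    moreover have "minor_term J q (x(c := y)) = minor_term J q x"
      using J q by (intro minor_term_cong) (auto simp: permutes_in_image)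
    ultimately show ?thesis unfolding marked_term_def by (simp add: qc)
  qed
  then show ?thesis
    by (subst product_integral_insert[OF J marked_term_integrable]) (auto simp: J q' ktrace_def)
qed

lemma integral_marked_term_merge:
  assumes J: "finite J" "c \<notin> J" and q: "q permutes J" and c': "c' \<in> J"
  shows "(LINT x|PiM (insert c J) (\<lambda>_. M). marked_term (insert c J) c k (Transposition.transpose c (q c') \<circ> q) x)
       = (LINT x|PiM J (\<lambda>_. M). marked_term J c' (Suc k) q x)"
proof -
  \<comment> \<open>This permutation inserts \<open>c\<close> into the cycle of \<open>q\<close>
    between \<open>c'\<close> and \<open>q c'\<close>, also when \<open>c'\<close> is a fixed point
    of \<open>q\<close>.\<close>
  let ?p = "Transposition.transpose c (q c') \<circ> q"
  have qJ: "q i \<in> J \<longleftrightarrow> i \<in> J" for i using q by (simp add: permutes_in_image)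
  have p: "?p permutes insert c J"
    using q qJ c' by (intro permutes_compose permutes_swap_id) (auto intro: permutes_subset)
  have qc: "q c = c" using q J by (simp add: permutes_not_in)
  have pc: "?p c = q c'" using qc by simp
  have pc': "?p c' = c" by simp
  have pi: "?p i = q i" if "i \<in> J - {c'}" for i
  proof -
    have "q i \<noteq> q c'" using that permutes_inj[OF q] by (auto dest: injD)
    moreover have "q i \<noteq> c" using that qJ J by auto
    ultimately show ?thesis by (simp add: Transposition.transpose_def)
  qed
  have "marked_term (insert c J) c k ?p (x(c := y))
      = (G (x c') y * kpow k y (x (q c'))) * minor_term (J - {c'}) q x" for x y
  proof -
    have *: "insert c J - {c} = J" "c' \<noteq> c" "q c' \<noteq> c" using J c' qJ by auto
    have "minor_term J ?p (x(c := y)) = G (x c') y * minor_term (J - {c'}) ?p (x(c := y))"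
      unfolding minor_term_def using prod.remove[OF J(1) c', of "\<lambda>i. G ((x(c := y)) i) ((x(c := y)) (?p i))"] * pc'
      by simp
    also have "minor_term (J - {c'}) ?p (x(c := y)) = minor_term (J - {c'}) q x"
      using J pi qJ by (intro minor_term_cong) auto
    finally have "minor_term J ?p (x(c := y)) = G (x c') y * minor_term (J - {c'}) q x" .
    then show ?thesis unfolding marked_term_def * pc using * by (simp del: o_apply)
  qed
  then show ?thesis
    by (subst product_integral_insert[OF J marked_term_integrable]) (auto simp: J p marked_term_def[of J, abs_def])
qed

text \<open>A permutation of \<open>insert c J\<close> either fixes \<open>c\<close>, which splits
  off a trace, or arises from a permutation of \<open>J\<close> by inserting \<open>c\<close> behind
  some \<open>c'\<close>. The insertion flips the sign, and integrating out \<open>c\<close> hands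
  the mark to \<open>c'\<close> with the power raised by one.\<close>

lemma marked_integral_insert:
  assumes J: "finite J" "c \<notin> J"
  shows "marked_integral (insert c J) c k
       = ktrace k * minor_integral J - (\<Sum>c'\<in>J. marked_integral J c' (Suc k))"
proof -
  let ?t = "\<lambda>p. LINT x|PiM (insert c J) (\<lambda>_. M). marked_term (insert c J) c k p x"
  let ?s = "\<lambda>c' q. LINT x|PiM J (\<lambda>_. M). marked_term J c' (Suc k) q x"
  have fin: "finite {q. q permutes J}" using J by (intro finite_permutations)
  have "marked_integral (insert c J) c k =
    (\<Sum>b\<in>insert c J. \<Sum>q | q permutes J. of_int (sign (Transposition.transpose c b \<circ> q)) * ?t (Transposition.transpose c b \<circ> q))"
    unfolding marked_integral_def by (rule sum_over_permutations_insert[OF J])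
  also have "\<dots> = (\<Sum>q | q permutes J. of_int (sign q) * ?t q)
     + (\<Sum>b\<in>J. \<Sum>q | q permutes J. of_int (sign (Transposition.transpose c b \<circ> q)) * ?t (Transposition.transpose c b \<circ> q))"
    using J by simp
  also have "(\<Sum>q | q permutes J. of_int (sign q) * ?t q) = ktrace k * minor_integral J"
    unfolding minor_integral_def sum_distrib_left
    by (intro sum.cong refl) (simp add: integral_marked_term_fixed[OF J])
  also have "(\<Sum>b\<in>J. \<Sum>q | q permutes J. of_int (sign (Transposition.transpose c b \<circ> q)) * ?t (Transposition.transpose c b \<circ> q))
     = (\<Sum>q | q permutes J. \<Sum>b\<in>J. of_int (sign (Transposition.transpose c b \<circ> q)) * ?t (Transposition.transpose c b \<circ> q))"
    by (rule sum.swap)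
  also have "\<dots> = (\<Sum>q | q permutes J. \<Sum>c'\<in>J. - (of_int (sign q) * ?s c' q))"
  proof (rule sum.cong[OF refl])
    fix q assume "q \<in> {q. q permutes J}"
    then have q: "q permutes J" by simp
    \<comment> \<open>Here \<open>b\<close> is the image of \<open>c\<close>; substituting
      \<open>b = q c'\<close> parametrizes by the predecessor \<open>c'\<close> of \<open>c\<close>,
      which is the index that inherits the mark.\<close>
    have "(\<Sum>b\<in>J. of_int (sign (Transposition.transpose c b \<circ> q)) * ?t (Transposition.transpose c b \<circ> q))
      = (\<Sum>c'\<in>J. of_int (sign (Transposition.transpose c (q c') \<circ> q)) * ?t (Transposition.transpose c (q c') \<circ> q))"
      by (rule sum.reindex_bij_betw[OF permutes_imp_bij[OF q], symmetric])
    also have "\<dots> = (\<Sum>c'\<in>J. - (of_int (sign q) * ?s c' q))"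
    proof (intro sum.cong refl)
      fix c' assume c': "c' \<in> J"
      then have "q c' \<noteq> c" using q J by (metis permutes_in_image)
      then have "sign (Transposition.transpose c (q c') \<circ> q) = - sign q"
        using permutation_permutes J(1) q by (subst sign_compose) (auto simp: sign_swap_id permutation_swap_id)
      then show "of_int (sign (Transposition.transpose c (q c') \<circ> q)) * ?t (Transposition.transpose c (q c') \<circ> q)
          = - (of_int (sign q) * ?s c' q)"
        by (simp add: integral_marked_term_merge[OF J q c'])
    qed
    finally show "(\<Sum>b\<in>J. of_int (sign (Transposition.transpose c b \<circ> q)) * ?t (Transposition.transpose c b \<circ> q))
      = (\<Sum>c'\<in>J. - (of_int (sign q) * ?s c' q))" .
  qed
  also have "\<dots> = - (\<Sum>c'\<in>J. marked_integral J c' (Suc k))"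
    unfolding marked_integral_def by (subst sum.swap) (simp add: sum_negf)
  finally show ?thesis by simp
qed

text \<open>Unrolling the recursion over the removal of indices: each round flips the sign, raises
  the power and leaves one index fewer. The inner value is the same for all \<open>Suc m\<close>
  choices of \<open>c'\<close>, which turns \<open>fact m\<close> into \<open>fact (Suc m)\<close>.
  For \<open>k = 0\<close> the sum is the right-hand side of Newton's identity.\<close>

lemma marked_integral_closed:
  assumes d: "\<And>J :: 'i set. finite J \<Longrightarrow> card J \<le> n \<Longrightarrow> minor_integral J = fact (card J) * d (card J)"
    and I: "finite I" "card I = Suc m" "m \<le> n" "(c :: 'i) \<in> I"
  shows "marked_integral I c k = fact m * (\<Sum>j\<le>m. (-1)^j * ktrace (k + j) * d (m - j))"
  using I
proof (induction m arbitrary: I c k)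
  case 0
  then have "I = insert c {}" by (auto simp: card_Suc_eq)
  then show ?case using marked_integral_insert[of "{}" c k] d[of "{}"] by simp
next
  case (Suc m)
  define J where "J = I - {c}"
  have J: "finite J" "c \<notin> J" "card J = Suc m" and IJ: "I = insert c J"
    using Suc.prems by (auto simp: J_def)
  have "marked_integral I c k = ktrace k * minor_integral J - (\<Sum>c'\<in>J. marked_integral J c' (Suc k))"
    unfolding IJ using J by (intro marked_integral_insert)
  also have "minor_integral J = fact (Suc m) * d (Suc m)"
    using d[of J] J Suc.prems by simp
  also have "(\<Sum>c'\<in>J. marked_integral J c' (Suc k))
      = (\<Sum>c'\<in>J. fact m * (\<Sum>j\<le>m. (-1)^j * ktrace (Suc k + j) * d (m - j)))"
    using Suc.prems J by (intro sum.cong refl Suc.IH) auto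
  also have "\<dots> = fact (Suc m) * (\<Sum>j\<le>m. (-1)^j * ktrace (Suc k + j) * d (m - j))"
    using J by (simp add: algebra_simps)
  also have "ktrace k * (fact (Suc m) * d (Suc m)) - \<dots>
    = fact (Suc m) * (ktrace k * d (Suc m) + (\<Sum>j\<le>m. (-1)^Suc j * ktrace (k + Suc j) * d (Suc m - Suc j)))"
    by (simp add: algebra_simps sum_negf)
  also have "\<dots> = fact (Suc m) * (\<Sum>j\<le>Suc m. (-1)^j * ktrace (k + j) * d (Suc m - j))"
    by (subst sum.atMost_Suc_shift) simp
  finally show ?case .
qed

definition dcoeff :: "nat \<Rightarrow> complex" where
  "dcoeff n = minor_integral {..<n} / fact n"

text \<open>That a minor integral depends only on the number of indices is shown without renaming
  variables: by strong induction, \<open>J\<close> and the initial segment of the same size both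
  have the value that the closed formula computes from smaller coefficients.\<close>

lemma minor_integral_dcoeff:
  fixes J :: "nat set"
  assumes "finite J"
  shows "minor_integral J = fact (card J) * dcoeff (card J)"
proof -
  have "\<forall>J :: nat set. finite J \<and> card J = n \<longrightarrow> minor_integral J = fact n * dcoeff n" for n
  proof (induction n rule: less_induct)
    case (less n)
    show ?case
    proof (cases n)
      case 0
      then show ?thesis by (auto simp: dcoeff_def)
    next
      case (Suc m)
      have "minor_integral J = fact m * (\<Sum>j\<le>m. (-1)^j * ktrace (0 + j) * dcoeff (m - j))"
        if J: "finite J" "card J = n" for J :: "nat set"
      proof -
        obtain c where c: "c \<in> J" using J Suc by fastforce
        have "marked_integral J c 0 = fact m * (\<Sum>j\<le>m. (-1)^j * ktrace (0 + j) * dcoeff (m - j))"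
          using less Suc J c by (intro marked_integral_closed[where n = m]) auto
        then show ?thesis using minor_integral_eq_marked[OF J(1) c] by simp
      qed
      from this[of "{..<n}"] this show ?thesis by (simp add: dcoeff_def)
    qed
  qed
  then show ?thesis using assms by blast
qed

lemma newton_dcoeff:
  "of_nat (Suc n) * dcoeff (Suc n) = (\<Sum>j\<le>n. (-1)^j * ktrace j * dcoeff (n - j))"
proof -
  have "minor_integral {..<Suc n} = marked_integral {..<Suc n} n 0"
    by (rule minor_integral_eq_marked) auto
  also have "\<dots> = fact n * (\<Sum>j\<le>n. (-1)^j * ktrace (0 + j) * dcoeff (n - j))"
    by (rule marked_integral_closed[where n = n]) (auto intro: minor_integral_dcoeff)
  finally have "fact n * (of_nat (Suc n) * dcoeff (Suc n)) = fact n * (\<Sum>j\<le>n. (-1)^j * ktrace j * dcoeff (n - j))"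
    by (simp add: dcoeff_def field_simps del: of_nat_Suc)
  then show ?thesis using fact_nonzero mult_left_cancel by blast
qed

theorem dcoeff_sums_exp:
  assumes "mass < 1"
  shows "dcoeff sums exp (\<Sum>k. (-1)^k * ktrace k / of_nat (Suc k))"
proof (rule newton_identities_sums_exp[OF _ newton_dcoeff mass_nonneg assms ktrace_le])
  \<comment> \<open>The product measure over no indices is a unit point mass, and the only term is
    an empty product.\<close>
  show "dcoeff 0 = 1"
    by (simp add: dcoeff_def minor_integral_def minor_term_def PiM_empty lebesgue_integral_count_space_finite)
qed

lemma dcoeff_eq_integral:
  "dcoeff n = (LINT x|PiM {..<n} (\<lambda>_. M).
     (\<Sum>p | p permutes {..<n}. of_int (sign p) * (\<Prod>i<n. G (x i) (x (p i))))) / fact n"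
  unfolding dcoeff_def minor_integral_def
proof (subst Bochner_Integration.integral_sum)
  fix p assume "p \<in> {p. p permutes {..<n}}"
  then show "integrable (PiM {..<n} (\<lambda>_. M)) (\<lambda>x. of_int (sign p) * (\<Prod>i<n. G (x i) (x (p i))))"
    using minor_term_integrable[of "{..<n}" p] unfolding minor_term_def
    by (intro integrable_mult_right) auto
qed (simp add: minor_term_def[abs_def])

end

lemma fredholm_det_eq_exp:
  assumes "dominated_kernel (restrict_space lborel {0<..}) G g"
    and "dominated_kernel.mass (restrict_space lborel {0<..}) g < 1"
  shows "fredholm_det G =
    exp (\<Sum>k. (-1)^k * dominated_kernel.ktrace (restrict_space lborel {0<..}) G k / of_nat (Suc k))"
proof -
  interpret dominated_kernel "restrict_space lborel {0<..}" G g by fact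
  show ?thesis
    using dcoeff_sums_exp[OF assms(2)] unfolding fredholm_det_def fred_minor_def
    by (simp add: dcoeff_eq_integral[abs_def] sums_iff)
qed

section \<open>Iterated kernels on a half-line\<close>

text \<open>The model for \<open>g u\<close> is \<open>sqrt (W u u)\<close>. The kernel lives on the
  whole line and half-lines are imposed by conditionals in the integrand, so that a single measure
  serves for every endpoint. Continuity is asked for only on the open half-line, since
  \<open>g\<close> may blow up at 0.\<close>

locale marchenko_kernel =
  fixes W :: "real \<Rightarrow> real \<Rightarrow> real" and g :: "real \<Rightarrow> real"
  assumes W_measurable: "(\<lambda>(u, v). W u v) \<in> borel_measurable (borel \<Otimes>\<^sub>M borel)"
    and g_measurable [measurable]: "g \<in> borel_measurable borel"
    and g_nonneg: "0 \<le> g u"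
    and g_integrable: "integrable lborel (\<lambda>u. (g u)\<^sup>2)"
    and g_mass: "(LINT u|lborel. (g u)\<^sup>2) \<le> 1"
    and W_le: "\<bar>W u v\<bar> \<le> g u * g v"
    and g_continuous: "continuous_on {0<..} g"
    and W_continuous: "continuous_on ({0<..} \<times> {0<..}) (\<lambda>(u, v). W u v)"
begin

text \<open>Kernel of the power k + 1, the intermediate variables being confined to (s, \<infinity>)
  and \<open>u\<close>, \<open>v\<close> left free. Keeping \<open>s\<close> apart from the outer
  arguments makes it possible to vary the endpoint alone.\<close>

primrec V :: "nat \<Rightarrow> real \<Rightarrow> real \<Rightarrow> real \<Rightarrow> real" where
  "V 0 s u v = W u v"
| "V (Suc k) s u v = (LINT y|lborel. (if s < y then W u y * V k s y v else 0))"

lemma W_measurable' [measurable (raw)]: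
  assumes "f \<in> borel_measurable N" "h \<in> borel_measurable N"
  shows "(\<lambda>x. W (f x) (h x)) \<in> borel_measurable N"
  using measurable_compose[OF measurable_Pair[OF assms] W_measurable] by simp

lemma V_measurable: "(\<lambda>(s, u, v). V k s u v) \<in> borel_measurable (borel \<Otimes>\<^sub>M borel \<Otimes>\<^sub>M borel)"
proof (induction k)
  case 0
  then show ?case unfolding V.simps by measurable
next
  case (Suc k)
  have [measurable (raw)]: "(\<lambda>x. V k (f x) (h x) (l x)) \<in> borel_measurable N"
    if "f \<in> borel_measurable N" "h \<in> borel_measurable N" "l \<in> borel_measurable N" for f h l N
    using measurable_compose[OF measurable_Pair[OF that(1) measurable_Pair[OF that(2,3)]] Suc] by simp
  show ?case unfolding V.simps by measurable
qed

lemma V_measurable' [measurable (raw)]: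
  assumes "f \<in> borel_measurable N" "h \<in> borel_measurable N" "l \<in> borel_measurable N"
  shows "(\<lambda>x. V k (f x) (h x) (l x)) \<in> borel_measurable N"
  using measurable_compose[OF measurable_Pair[OF assms(1) measurable_Pair[OF assms(2,3)]] V_measurable] by simp

lemma dominated_integrable:
  fixes f :: "real \<Rightarrow> 'b::{banach, second_countable_topology}"
  assumes "f \<in> borel_measurable borel" and "\<And>y. norm (f y) \<le> C * (g y)\<^sup>2"
  shows "integrable lborel f"
proof (rule Bochner_Integration.integrable_bound)
  show "integrable lborel (\<lambda>y. C * (g y)\<^sup>2)" by (intro integrable_mult_right g_integrable)
  show "AE y in lborel. norm (f y) \<le> norm (C * (g y)\<^sup>2)"
    by (intro always_eventually allI order_trans[OF assms(2)]) (simp only: real_norm_def abs_ge_self)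
qed (use assms in simp)

lemma dominated_integral_le:
  fixes f :: "real \<Rightarrow> 'b::{banach, second_countable_topology}"
  assumes "\<And>y. norm (f y) \<le> C * (g y)\<^sup>2" "0 \<le> C"
  shows "norm (LINT y|lborel. f y) \<le> C"
proof -
  have "norm (LINT y|lborel. f y) \<le> (LINT y|lborel. C * (g y)\<^sup>2)"
    using assms by (intro norm_integral_le_dominated integrable_mult_right g_integrable)
  also have "\<dots> = C * (LINT y|lborel. (g y)\<^sup>2)" by simp
  also have "\<dots> \<le> C * 1" using assms g_mass by (intro mult_left_mono)
  finally show ?thesis by simp
qed

lemma product_le:
  assumes "\<bar>a\<bar> \<le> g u * g y" "\<bar>b\<bar> \<le> g y * g v"
  shows "\<bar>a * b\<bar> \<le> g u * g v * (g y)\<^sup>2"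
proof -
  have "\<bar>a * b\<bar> \<le> (g u * g y) * (g y * g v)"
    unfolding abs_mult using assms by (intro mult_mono) (auto simp: g_nonneg)
  then show ?thesis by (simp add: algebra_simps power2_eq_square)
qed

text \<open>The bound does not deteriorate with \<open>k\<close>, because every integration costs a
  factor of at most the total mass of \<open>g\<^sup>2\<close>, which is at most 1.\<close>

lemma V_le: "\<bar>V k s u v\<bar> \<le> g u * g v"
proof (induction k arbitrary: u v)
  case 0
  then show ?case by (simp add: W_le)
next
  case (Suc k)
  have "norm (V (Suc k) s u v) \<le> g u * g v"
    unfolding V.simps using product_le[OF W_le Suc]
    by (intro dominated_integral_le) (auto simp: g_nonneg)
  then show ?case by simp
qed

lemma pair_dominated_integrable:
  fixes f :: "real \<Rightarrow> real \<Rightarrow> real"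
  assumes meas: "(\<lambda>(y, t). f y t) \<in> borel_measurable (borel \<Otimes>\<^sub>M borel)"
    and le: "\<And>y t. \<bar>f y t\<bar> \<le> C * (g y)\<^sup>2 * (g t)\<^sup>2"
  shows "integrable (lborel \<Otimes>\<^sub>M lborel) (\<lambda>(y, t). f y t)"
proof (rule lborel_pair.Fubini_integrable)
  have m: "(\<lambda>(y, t). f y t) \<in> borel_measurable (lborel \<Otimes>\<^sub>M lborel)"
    using meas by (simp cong: measurable_cong_sets)
  then show "(\<lambda>(y, t). f y t) \<in> borel_measurable (lborel \<Otimes>\<^sub>M lborel)" .
  have mi: "(\<lambda>y. LINT t|lborel. \<bar>f y t\<bar>) \<in> borel_measurable borel"
    using meas by measurable
  have "norm (LINT t|lborel. norm (f y t)) \<le> \<bar>C\<bar> * (g y)\<^sup>2" for y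
  proof (intro dominated_integral_le)
    fix t
    have "\<bar>f y t\<bar> \<le> C * ((g y)\<^sup>2 * (g t)\<^sup>2)" using le by (simp add: mult.assoc)
    also have "\<dots> \<le> \<bar>C\<bar> * ((g y)\<^sup>2 * (g t)\<^sup>2)" by (intro mult_right_mono) auto
    finally show "norm (norm (f y t)) \<le> \<bar>C\<bar> * (g y)\<^sup>2 * (g t)\<^sup>2" by (simp add: mult.assoc)
  qed auto
  then show "integrable lborel (\<lambda>y. LINT t|lborel. norm (case (y, t) of (y, t) \<Rightarrow> f y t))"
    by (intro dominated_integrable) (auto intro: mi)
  have "integrable lborel (\<lambda>t. f y t)" for y
    using meas le by (intro dominated_integrable[where C = "C * (g y)\<^sup>2"]) (auto intro: measurable_Pair2')
  then show "AE y in lborel. integrable lborel (\<lambda>t. case (y, t) of (y, t) \<Rightarrow> f y t)" by simp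
qed

text \<open>Product of the powers i + 1 and j + 1, whence the \<open>Suc\<close>. The recursion for
  \<open>V\<close> splits off the first factor only; splitting elsewhere is what the Marchenko
  equation and the closing of cycles in traces require.\<close>

lemma V_Suc_add:
  "V (Suc (i + j)) s u v = (LINT y|lborel. (if s < y then V i s u y * V j s y v else 0))"
proof (induction i arbitrary: u)
  case 0
  then show ?case by (simp cong: if_cong)
next
  case (Suc i)
  define F where "F y z = (if s < y \<and> s < z then W u y * (V i s y z * V j s z v) else 0)" for y z
  have F: "\<bar>F y z\<bar> \<le> g u * g v * (g y)\<^sup>2 * (g z)\<^sup>2" for y z
  proof -
    have "\<bar>W u y * (V i s y z * V j s z v)\<bar> \<le> (g u * g y) * (g y * g v * (g z)\<^sup>2)"
      unfolding abs_mult[of "W u y"] by (intro mult_mono W_le product_le V_le) (auto simp: g_nonneg)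
    then show ?thesis by (auto simp: F_def g_nonneg algebra_simps power2_eq_square)
  qed
  have int: "integrable (lborel \<Otimes>\<^sub>M lborel) (\<lambda>(y, z). F y z)"
    by (rule pair_dominated_integrable[OF _ F]) (unfold F_def, measurable)
  have "V (Suc (Suc i + j)) s u v = (LINT y|lborel. (if s < y then W u y * V (Suc (i + j)) s y v else 0))"
    by simp
  also have "\<dots> = (LINT y|lborel. LINT z|lborel. F y z)"
    unfolding Suc F_def
    by (intro Bochner_Integration.integral_cong refl) (auto simp flip: integral_mult_right_zero intro!: Bochner_Integration.integral_cong)
  also have "\<dots> = (LINT z|lborel. LINT y|lborel. F y z)"
    by (rule lborel_pair.Fubini_integral[OF int, symmetric])
  also have "\<dots> = (LINT z|lborel. (if s < z then V (Suc i) s u z * V j s z v else 0))"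
    unfolding V.simps F_def
    by (intro Bochner_Integration.integral_cong refl) (auto simp flip: integral_mult_left_zero intro!: Bochner_Integration.integral_cong)
  finally show ?case .
qed

text \<open>The quadrant is cut along its diagonal, a null set, and on one half the order of
  integration is exchanged. In both resulting integrals the smaller variable is the outer one and
  can act as a new left endpoint for the other.\<close>

lemma integral_split_diagonal:
  assumes meas: "(\<lambda>(y, t). f y t) \<in> borel_measurable (borel \<Otimes>\<^sub>M borel)"
    and le: "\<And>y t. \<bar>f y t\<bar> \<le> C * (g y)\<^sup>2 * (g t)\<^sup>2" and C: "0 \<le> C"
  shows "(LINT y|lborel. (if a < y then LINT t|lborel. (if a < t then f y t else 0) else 0))
    = (LINT t|lborel. (if a < t then LINT y|lborel. (if t < y then f y t else 0) else 0))
    + (LINT y|lborel. (if a < y then LINT t|lborel. (if y < t then f y t else 0) else (0::real)))"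
proof -
  define F1 where "F1 y t = (if a < t \<and> t < y then f y t else 0)" for y t
  define F2 where "F2 y t = (if a < y \<and> y < t then f y t else 0)" for y t
  have f [measurable (raw)]: "(\<lambda>x. f (h x) (l x)) \<in> borel_measurable N"
    if "h \<in> borel_measurable N" "l \<in> borel_measurable N" for h l N
    using measurable_compose[OF measurable_Pair[OF that] meas] by simp
  have [measurable]: "(\<lambda>(y, t). F1 y t) \<in> borel_measurable (borel \<Otimes>\<^sub>M borel)"
    "(\<lambda>(y, t). F2 y t) \<in> borel_measurable (borel \<Otimes>\<^sub>M borel)"
    unfolding F1_def F2_def by measurable
  have le12: "\<bar>F1 y t\<bar> \<le> C * (g y)\<^sup>2 * (g t)\<^sup>2" "\<bar>F2 y t\<bar> \<le> C * (g y)\<^sup>2 * (g t)\<^sup>2" for y t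
    using le C by (auto simp: F1_def F2_def)
  have int1: "integrable (lborel \<Otimes>\<^sub>M lborel) (\<lambda>(y, t). F1 y t)"
    and int2: "integrable (lborel \<Otimes>\<^sub>M lborel) (\<lambda>(y, t). F2 y t)"
    by (rule pair_dominated_integrable[OF _ le12(1)] pair_dominated_integrable[OF _ le12(2)]; measurable)+
  have inner: "integrable lborel (F1 y)" "integrable lborel (F2 y)" for y
    using le12 by (auto intro!: dominated_integrable[where C = "C * (g y)\<^sup>2"] simp: F1_def F2_def)
  have "(if a < y then LINT t|lborel. (if a < t then f y t else 0) else 0)
      = (LINT t|lborel. F1 y t) + (LINT t|lborel. F2 y t)" for y
  proof -
    have "(if a < y then LINT t|lborel. (if a < t then f y t else 0) else 0)
      = (LINT t|lborel. (if a < y \<and> a < t then f y t else 0))" by simp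
    also have "\<dots> = (LINT t|lborel. F1 y t + F2 y t)"
    proof (rule integral_cong_AE)
      show "AE t in lborel. (if a < y \<and> a < t then f y t else 0) = F1 y t + F2 y t"
        using AE_lborel_singleton[of y] by eventually_elim (auto simp: F1_def F2_def)
    qed (unfold F1_def F2_def, measurable)
    also have "\<dots> = (LINT t|lborel. F1 y t) + (LINT t|lborel. F2 y t)"
      by (intro Bochner_Integration.integral_add inner)
    finally show ?thesis .
  qed
  then have "(LINT y|lborel. (if a < y then LINT t|lborel. (if a < t then f y t else 0) else 0))
     = (LINT y|lborel. (LINT t|lborel. F1 y t) + (LINT t|lborel. F2 y t))" by simp
  also have "\<dots> = (LINT y|lborel. LINT t|lborel. F1 y t) + (LINT y|lborel. LINT t|lborel. F2 y t)"
    using lborel_pair.integrable_fst[OF int1] lborel_pair.integrable_fst[OF int2]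
    by (intro Bochner_Integration.integral_add) auto
  also have "(LINT y|lborel. LINT t|lborel. F1 y t) = (LINT t|lborel. LINT y|lborel. F1 y t)"
    by (rule lborel_pair.Fubini_integral[OF int1, symmetric])
  also have "\<dots> = (LINT t|lborel. (if a < t then LINT y|lborel. (if t < y then f y t else 0) else 0))"
    unfolding F1_def by (intro Bochner_Integration.integral_cong refl) auto
  also have "(LINT y|lborel. LINT t|lborel. F2 y t) = (LINT y|lborel. (if a < y then LINT t|lborel. (if y < t then f y t else 0) else 0))"
    unfolding F2_def by (intro Bochner_Integration.integral_cong refl) auto
  finally show ?thesis .
qed

text \<open>\<open>- S k t u v\<close> is the derivative of \<open>V k t u v\<close> with respect to \<open>t\<close>.\<close>

definition S :: "nat \<Rightarrow> real \<Rightarrow> real \<Rightarrow> real \<Rightarrow> real" where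
  "S k t u v = (\<Sum>i<k. V i t u t * V (k - Suc i) t t v)"

lemma S_measurable [measurable (raw)]:
  assumes [measurable]: "f \<in> borel_measurable N" "h \<in> borel_measurable N" "l \<in> borel_measurable N"
  shows "(\<lambda>x. S k (f x) (h x) (l x)) \<in> borel_measurable N"
  unfolding S_def by measurable

lemma S_le: "\<bar>S k t u v\<bar> \<le> real k * (g u * g v * (g t)\<^sup>2)"
proof -
  have "\<bar>S k t u v\<bar> \<le> (\<Sum>i<k. g u * g v * (g t)\<^sup>2)"
    unfolding S_def by (intro order_trans[OF sum_abs] sum_mono product_le V_le)
  then show ?thesis by simp
qed

text \<open>The product rule in integrated form: \<open>a\<close> is the lower limit of
  \<open>k\<close> integrations, and each of them contributes one summand of \<open>S\<close>. The
  conditional is the value at \<open>a\<close> = \<infinity>, where a kernel with at least one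
  integration vanishes.\<close>

lemma V_eq_integral_S:
  "V k a u v = (if k = 0 then W u v else 0) + (LINT t|lborel. (if a < t then S k t u v else 0))"
proof (induction k arbitrary: a u)
  case 0
  then show ?case by (simp add: S_def cong: if_cong)
next
  case (Suc k)
  define d where "d y = (if k = 0 then W y v else 0)" for y
  define f where "f y t = W u y * S k t y v" for y t
  have [measurable]: "d \<in> borel_measurable borel" unfolding d_def by measurable
  have f_meas: "(\<lambda>(y, t). f y t) \<in> borel_measurable (borel \<Otimes>\<^sub>M borel)"
    unfolding f_def by measurable
  have f_le: "\<bar>f y t\<bar> \<le> (real k * (g u * g v)) * (g y)\<^sup>2 * (g t)\<^sup>2" for y t
  proof -
    have "\<bar>f y t\<bar> \<le> (g u * g y) * (real k * (g y * g v * (g t)\<^sup>2))"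
      unfolding f_def abs_mult by (intro mult_mono W_le S_le) (auto simp: g_nonneg)
    then show ?thesis by (simp add: algebra_simps power2_eq_square)
  qed
  have d_le: "\<bar>d y\<bar> \<le> g y * g v" for y using W_le by (simp add: d_def g_nonneg)
  have int_d: "integrable lborel (\<lambda>y. if a < y then W u y * d y else 0)"
    using product_le[OF W_le d_le] by (intro dominated_integrable[where C = "g u * g v"]) (auto simp: g_nonneg)
  have int_le: "\<bar>LINT t|lborel. (if b y < t then f y t else 0)\<bar> \<le> (real k * (g u * g v)) * (g y)\<^sup>2" for y and b :: "real \<Rightarrow> real"
    unfolding real_norm_def[symmetric]
    using f_le by (intro dominated_integral_le) (auto simp: g_nonneg)
  have int_f: "integrable lborel (\<lambda>y. if a < y then LINT t|lborel. (if b y < t then f y t else 0) else 0)"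
    if [measurable]: "b \<in> borel_measurable borel" for b
    using f_meas int_le[of b] by (intro dominated_integrable[where C = "real k * (g u * g v)"]) (auto simp: g_nonneg)
  have IH: "W u y * V k b y v = W u y * d y + (LINT t|lborel. (if b < t then f y t else 0))" for b y
    unfolding Suc.IH[of b y] f_def d_def
    unfolding distrib_left integral_mult_right_zero[symmetric]
    by (intro arg_cong2[where f = "(+)"] Bochner_Integration.integral_cong refl) auto
  \<comment> \<open>Integrating over y > t absorbs the leading \<open>W u y\<close> into the left
    factor of each summand of \<open>S k\<close>, giving the summands of \<open>S (Suc k)\<close>
    other than the one for \<open>i = 0\<close>.\<close>
  have inner: "(LINT y|lborel. (if t < y then f y t else 0)) = (\<Sum>i<k. V (Suc i) t u t * V (k - Suc i) t t v)" for t
  proof -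
    have "(LINT y|lborel. (if t < y then f y t else 0))
        = (LINT y|lborel. (\<Sum>i<k. (if t < y then W u y * V i t y t else 0) * V (k - Suc i) t t v))"
      unfolding f_def S_def
      by (intro Bochner_Integration.integral_cong refl) (auto simp: sum_distrib_left mult.assoc)
    also have "\<dots> = (\<Sum>i<k. V (Suc i) t u t * V (k - Suc i) t t v)"
    proof (subst Bochner_Integration.integral_sum)
      fix i
      have "integrable lborel (\<lambda>y. if t < y then W u y * V i t y t else 0)"
        using product_le[OF W_le V_le] by (intro dominated_integrable[where C = "g u * g t"]) (auto simp: g_nonneg)
      then show "integrable lborel (\<lambda>y. (if t < y then W u y * V i t y t else 0) * V (k - Suc i) t t v)"
        by (rule integrable_mult_left)
    qed simp
    finally show ?thesis .
  qed
  have int_first: "integrable lborel (\<lambda>t. if a < t then LINT y|lborel. (if t < y then f y t else 0) else 0)"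
  proof (rule dominated_integrable[where C = "real k * (g u * g v)"])
    show "(\<lambda>t. if a < t then LINT y|lborel. (if t < y then f y t else 0) else 0) \<in> borel_measurable borel"
      using f_meas by measurable
    fix t
    have "norm (LINT y|lborel. (if t < y then f y t else 0)) \<le> (real k * (g u * g v)) * (g t)\<^sup>2"
      using f_le by (intro dominated_integral_le) (auto simp: g_nonneg algebra_simps)
    then show "norm (if a < t then LINT y|lborel. (if t < y then f y t else 0) else 0) \<le> (real k * (g u * g v)) * (g t)\<^sup>2"
      by (auto simp: g_nonneg)
  qed
  have "V (Suc k) a u v = (LINT y|lborel. (if a < y then W u y * d y else 0)
      + (if a < y then LINT t|lborel. (if a < t then f y t else 0) else 0))"
    unfolding V.simps IH by (intro Bochner_Integration.integral_cong refl) auto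
  also have "\<dots> = (LINT y|lborel. (if a < y then W u y * d y else 0))
      + (LINT y|lborel. (if a < y then LINT t|lborel. (if a < t then f y t else 0) else 0))"
    by (intro Bochner_Integration.integral_add int_d int_f) auto
  also have "(LINT y|lborel. (if a < y then LINT t|lborel. (if a < t then f y t else 0) else 0))
    = (LINT t|lborel. (if a < t then LINT y|lborel. (if t < y then f y t else 0) else 0))
    + (LINT y|lborel. (if a < y then LINT t|lborel. (if y < t then f y t else 0) else 0))"
    by (rule integral_split_diagonal[OF f_meas f_le]) (simp add: g_nonneg)
  \<comment> \<open>With the smaller variable outside throughout, the last two terms recombine by
    \<open>IH\<close> at \<open>b = y\<close> to \<open>W u y * V k y y v\<close>, the missing
    summand for \<open>i = 0\<close>.\<close>
  also have "(LINT y|lborel. (if a < y then W u y * d y else 0)) + \<dots>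
    = (LINT y|lborel. (if a < y then LINT t|lborel. (if y < t then f t y else 0) else 0)
        + ((if a < y then W u y * d y else 0) + (if a < y then LINT t|lborel. (if y < t then f y t else 0) else 0)))"
    by (subst Bochner_Integration.integral_add[OF int_first Bochner_Integration.integrable_add[OF int_d int_f]],
        simp, subst Bochner_Integration.integral_add[OF int_d int_f]) auto
  also have "\<dots> = (LINT t|lborel. (if a < t then S (Suc k) t u v else 0))"
  proof -
    have "S (Suc k) t u v = W u t * V k t t v + (\<Sum>i<k. V (Suc i) t u t * V (k - Suc i) t t v)" for t
      unfolding S_def by (subst sum.lessThan_Suc_shift) simp
    then show ?thesis unfolding inner
      by (simp add: IH) (intro Bochner_Integration.integral_cong refl, auto)
  qed
  finally show ?case by simp
qed

text \<open>Integrated form of \<open>d/da tr (V k a) = - (k + 1) V k a a a\<close>.\<close>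

lemma trace_V:
  "(LINT y|lborel. (if a < y then V k a y y else 0)) = real (Suc k) * (LINT t|lborel. (if a < t then V k t t t else 0))"
proof -
  define d where "d y = (if k = 0 then W y y else 0)" for y
  define f where "f y t = S k t y y" for y t
  have [measurable]: "d \<in> borel_measurable borel" unfolding d_def by measurable
  have f_meas: "(\<lambda>(y, t). f y t) \<in> borel_measurable (borel \<Otimes>\<^sub>M borel)"
    unfolding f_def by measurable
  have f_le: "\<bar>f y t\<bar> \<le> real k * (g y)\<^sup>2 * (g t)\<^sup>2" for y t
    using S_le[of k t y y] by (simp add: f_def algebra_simps power2_eq_square)
  have d_le: "\<bar>d y\<bar> \<le> 1 * (g y)\<^sup>2" for y using W_le[of y y] by (simp add: d_def power2_eq_square)
  have int_d: "integrable lborel (\<lambda>y. if a < y then d y else 0)"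
    using d_le by (intro dominated_integrable[where C = 1]) auto
  have int_le: "\<bar>LINT t|lborel. (if b y < t then f y t else 0)\<bar> \<le> real k * (g y)\<^sup>2" for y and b :: "real \<Rightarrow> real"
    unfolding real_norm_def[symmetric]
    using f_le by (intro dominated_integral_le) (auto simp: g_nonneg)
  have int_f: "integrable lborel (\<lambda>y. if a < y then LINT t|lborel. (if b y < t then f y t else 0) else 0)"
    if [measurable]: "b \<in> borel_measurable borel" for b
    using f_meas int_le[of b] by (intro dominated_integrable[where C = "real k"]) (auto simp: g_nonneg)
  have V: "V k b y y = d y + (LINT t|lborel. (if b < t then f y t else 0))" for b y
    unfolding V_eq_integral_S[of k b y y] f_def d_def ..
  \<comment> \<open>Cyclicity of the trace: after exchanging the two factors,
    \<open>V_Suc_add\<close> closes the chain through \<open>y\<close>, so each of the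
    \<open>k\<close> summands gives the same value.\<close>
  have inner: "(LINT y|lborel. (if t < y then f y t else 0)) = real k * V k t t t" for t
  proof -
    have "(LINT y|lborel. (if t < y then f y t else 0))
        = (LINT y|lborel. (\<Sum>i<k. if t < y then V (k - Suc i) t t y * V i t y t else 0))"
      unfolding f_def S_def
      by (intro Bochner_Integration.integral_cong refl) (auto simp: mult.commute)
    also have "\<dots> = (\<Sum>i<k. V (Suc ((k - Suc i) + i)) t t t)"
      unfolding V_Suc_add
    proof (rule Bochner_Integration.integral_sum)
      show "integrable lborel (\<lambda>y. if t < y then V (k - Suc i) t t y * V i t y t else 0)" for i
        using product_le[OF V_le V_le] by (intro dominated_integrable[where C = "g t * g t"]) (auto simp: g_nonneg)
    qed
    also have "\<dots> = (\<Sum>i<k. V k t t t)" by (intro sum.cong) auto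
    finally show ?thesis by simp
  qed
  have "(LINT y|lborel. (if a < y then V k a y y else 0)) = (LINT y|lborel. (if a < y then d y else 0)
      + (if a < y then LINT t|lborel. (if a < t then f y t else 0) else 0))"
    unfolding V by (intro Bochner_Integration.integral_cong refl) auto
  also have "\<dots> = (LINT y|lborel. (if a < y then d y else 0))
      + (LINT y|lborel. (if a < y then LINT t|lborel. (if a < t then f y t else 0) else 0))"
    by (intro Bochner_Integration.integral_add int_d int_f) auto
  also have "(LINT y|lborel. (if a < y then LINT t|lborel. (if a < t then f y t else 0) else 0))
    = (LINT t|lborel. (if a < t then LINT y|lborel. (if t < y then f y t else 0) else 0))
    + (LINT y|lborel. (if a < y then LINT t|lborel. (if y < t then f y t else 0) else 0))"
    by (rule integral_split_diagonal[OF f_meas f_le]) simp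
  also have "(LINT t|lborel. (if a < t then LINT y|lborel. (if t < y then f y t else 0) else 0))
     = real k * (LINT t|lborel. (if a < t then V k t t t else 0))"
    unfolding inner integral_mult_right_zero[symmetric]
    by (intro Bochner_Integration.integral_cong refl) auto
  also have "(LINT y|lborel. (if a < y then d y else 0))
      + (real k * (LINT t|lborel. (if a < t then V k t t t else 0))
      + (LINT y|lborel. (if a < y then LINT t|lborel. (if y < t then f y t else 0) else 0)))
    = real k * (LINT t|lborel. (if a < t then V k t t t else 0))
      + (LINT y|lborel. (if a < y then d y else 0) + (if a < y then LINT t|lborel. (if y < t then f y t else 0) else 0))"
    by (subst Bochner_Integration.integral_add[OF int_d int_f]) auto
  \<comment> \<open>The boundary term and the half with y < t rebuild \<open>V k y y y\<close>; this
    is one more copy, which makes the factor \<open>Suc k\<close>.\<close>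
  also have "(LINT y|lborel. (if a < y then d y else 0) + (if a < y then LINT t|lborel. (if y < t then f y t else 0) else 0))
     = (LINT y|lborel. (if a < y then V k y y y else 0))"
    unfolding V by (intro Bochner_Integration.integral_cong refl) auto
  finally show ?thesis by (simp add: algebra_simps)
qed

end

section \<open>Joint continuity of the iterated kernels\<close>

context marchenko_kernel
begin

text \<open>Dominated convergence, by induction on \<open>k\<close>. All three arguments move at
  once because the diagonal \<open>V k t t t\<close> is what gets differentiated; \<open>u\<close>
  is generalized since the induction hypothesis is applied at the integration variable.\<close>

lemma V_tendsto:
  assumes "s \<longlonglongrightarrow> s0" "u \<longlonglongrightarrow> u0" "v \<longlonglongrightarrow> v0"
    and "\<And>n. 0 < s n" "\<And>n. 0 < u n" "\<And>n. 0 < v n" and "0 < s0" "0 < u0" "0 < v0"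
  shows "(\<lambda>n. V k (s n) (u n) (v n)) \<longlonglongrightarrow> V k s0 u0 v0"
  using assms
proof (induction k arbitrary: u u0)
  case (0 u u0)
  have "(\<lambda>n. (\<lambda>(u, v). W u v) (u n, v n)) \<longlonglongrightarrow> (\<lambda>(u, v). W u v) (u0, v0)"
    using 0 by (intro continuous_on_tendsto_compose[OF W_continuous] tendsto_Pair) auto
  then show ?case by simp
next
  case (Suc k u u0)
  \<comment> \<open>Along a sequence converging inside the open half-line \<open>g\<close> stays
    bounded; this gives a dominating function independent of \<open>n\<close>.\<close>
  have g_bdd: "\<exists>B\<ge>0. \<forall>n. g (x n) \<le> B" if "x \<longlonglongrightarrow> x0" "\<And>n. 0 < x n" "0 < x0" for x x0
  proof -
    have "(\<lambda>n. g (x n)) \<longlonglongrightarrow> g x0"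
      using that by (intro continuous_on_tendsto_compose[OF g_continuous]) auto
    then have "Bseq (\<lambda>n. g (x n))" by (intro convergent_imp_Bseq convergentI)
    then obtain B where "B > 0" "\<And>n. norm (g (x n)) \<le> B" by (auto elim: BseqE)
    then show ?thesis by (intro exI[of _ B]) (auto intro: order_trans[OF abs_ge_self])
  qed
  obtain B where B: "B \<ge> 0" "\<And>n. g (u n) \<le> B" using g_bdd[of u u0] Suc.prems by blast
  obtain C where C: "C \<ge> 0" "\<And>n. g (v n) \<le> C" using g_bdd[of v v0] Suc.prems by blast
  show ?case unfolding V.simps
  proof (rule integral_dominated_convergence[where w = "\<lambda>y. (B * C) * (g y)\<^sup>2"])
    show "integrable lborel (\<lambda>y. (B * C) * (g y)\<^sup>2)" by (intro integrable_mult_right g_integrable)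
    \<comment> \<open>The moving cut-off converges at every \<open>y\<close> except possibly at the
      limit endpoint \<open>s0\<close>.\<close>
    show "AE y in lborel. (\<lambda>n. if s n < y then W (u n) y * V k (s n) y (v n) else 0)
        \<longlonglongrightarrow> (if s0 < y then W u0 y * V k s0 y v0 else 0)"
      using AE_lborel_singleton[of s0]
    proof eventually_elim
      case (elim y)
      show ?case
      proof (cases "s0 < y")
        case True
        then have y: "0 < y" using Suc.prems by simp
        have "(\<lambda>n. (\<lambda>(u, v). W u v) (u n, y)) \<longlonglongrightarrow> (\<lambda>(u, v). W u v) (u0, y)"
          using Suc.prems y by (intro continuous_on_tendsto_compose[OF W_continuous] tendsto_Pair) auto
        then have "(\<lambda>n. W (u n) y * V k (s n) y (v n)) \<longlonglongrightarrow> W u0 y * V k s0 y v0"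
          using Suc.prems y by (intro tendsto_mult Suc.IH) auto
        moreover have "\<forall>\<^sub>F n in sequentially. s n < y"
          using Suc.prems(1) True by (rule order_tendstoD)
        then have "\<forall>\<^sub>F n in sequentially. W (u n) y * V k (s n) y (v n) = (if s n < y then W (u n) y * V k (s n) y (v n) else 0)"
          by eventually_elim simp
        ultimately show ?thesis using True by (simp add: Lim_transform_eventually)
      next
        case False
        then have "y < s0" using elim by simp
        with Suc.prems(1) have "\<forall>\<^sub>F n in sequentially. y < s n" by (rule order_tendstoD)
        then have "\<forall>\<^sub>F n in sequentially. (if s n < y then W (u n) y * V k (s n) y (v n) else 0) = 0"
          by eventually_elim simp
        then show ?thesis using False by (simp add: tendsto_eventually)
      qed
    qed
    show "AE y in lborel. norm (if s n < y then W (u n) y * V k (s n) y (v n) else 0) \<le> (B * C) * (g y)\<^sup>2" for n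
    proof (intro always_eventually allI)
      fix y
      have "\<bar>W (u n) y * V k (s n) y (v n)\<bar> \<le> g (u n) * g (v n) * (g y)\<^sup>2"
        by (intro product_le W_le V_le)
      also have "\<dots> \<le> (B * C) * (g y)\<^sup>2"
        using B C by (intro mult_right_mono mult_mono) (auto simp: g_nonneg)
      finally show "norm (if s n < y then W (u n) y * V k (s n) y (v n) else 0) \<le> (B * C) * (g y)\<^sup>2"
        using B C by (auto simp: g_nonneg)
    qed
  qed measurable
qed

lemma V_diagonal_continuous: "continuous_on {0<..} (\<lambda>t. V k t t t)"
  unfolding continuous_on_sequentially comp_def by (auto intro!: V_tendsto)

end

section \<open>The Marchenko equation\<close>

locale marchenko_coupling = marchenko_kernel +
  fixes \<kappa> :: complex
  assumes coupling: "cmod \<kappa> < 1"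
begin

lemma coupling_sq: "(cmod \<kappa>)\<^sup>2 < 1"
  using coupling by (simp add: power_less_one_iff)

lemma geometric_summable: "summable (\<lambda>k. ((cmod \<kappa>)\<^sup>2) ^ k)"
  using coupling_sq by (intro summable_geometric) simp

text \<open>The Neumann series of the Marchenko equation. The cut-off is tied to the first argument
  because \<open>x\<close> enters that equation only as a parameter.\<close>

definition K :: "real \<Rightarrow> real \<Rightarrow> complex" where
  "K x z = \<kappa> * (\<Sum>k. (\<kappa>\<^sup>2) ^ k * of_real (V k x x z))"

definition K_bound :: real where
  "K_bound = cmod \<kappa> * (\<Sum>k. ((cmod \<kappa>)\<^sup>2) ^ k)"

lemma K_bound_nonneg: "0 \<le> K_bound"
  unfolding K_bound_def using geometric_summable by (intro mult_nonneg_nonneg suminf_nonneg) auto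

lemma K_term_le: "norm ((\<kappa>\<^sup>2) ^ k * complex_of_real (V k s u v)) \<le> ((cmod \<kappa>)\<^sup>2) ^ k * (g u * g v)"
  using V_le by (auto simp: norm_mult norm_power intro!: mult_left_mono)

lemma K_term_norm_summable: "summable (\<lambda>k. norm ((\<kappa>\<^sup>2) ^ k * complex_of_real (V k s u v)))"
  by (rule summable_comparison_test'[of "\<lambda>k. ((cmod \<kappa>)\<^sup>2) ^ k * (g u * g v)" 0])
     (use K_term_le geometric_summable in \<open>auto intro: summable_mult2\<close>)

lemma K_term_summable: "summable (\<lambda>k. (\<kappa>\<^sup>2) ^ k * complex_of_real (V k s u v))"
  by (rule summable_norm_cancel[OF K_term_norm_summable])

lemma K_le: "norm (K x z) \<le> K_bound * (g x * g z)"
proof -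
  have "norm (\<Sum>k. (\<kappa>\<^sup>2) ^ k * complex_of_real (V k x x z)) \<le> (\<Sum>k. ((cmod \<kappa>)\<^sup>2) ^ k * (g x * g z))"
    by (intro order_trans[OF summable_norm[OF K_term_norm_summable]] suminf_le K_term_le K_term_norm_summable summable_mult2 geometric_summable)
  also have "\<dots> = (\<Sum>k. ((cmod \<kappa>)\<^sup>2) ^ k) * (g x * g z)" by (rule suminf_mult2[OF geometric_summable, symmetric])
  finally show ?thesis unfolding K_def K_bound_def norm_mult
    by (simp add: mult_left_mono mult.assoc)
qed

lemma K_measurable [measurable (raw)]:
  assumes [measurable]: "f \<in> borel_measurable N" "h \<in> borel_measurable N"
  shows "(\<lambda>x. K (f x) (h x)) \<in> borel_measurable N"
  unfolding K_def by measurable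

lemma K_W_integrable: "integrable lborel (\<lambda>y. if x < y then K x y * complex_of_real (W y z) else 0)"
proof (rule dominated_integrable)
  fix y
  have "norm (K x y * complex_of_real (W y z)) \<le> (K_bound * (g x * g y)) * (g y * g z)"
    unfolding norm_mult using W_le by (intro mult_mono K_le) (auto simp: K_bound_nonneg g_nonneg)
  then show "norm (if x < y then K x y * complex_of_real (W y z) else 0) \<le> (K_bound * (g x * g z)) * (g y)\<^sup>2"
    by (auto simp: g_nonneg K_bound_nonneg algebra_simps power2_eq_square)
qed measurable

text \<open>Multiplication by \<open>W\<close> from the right turns \<open>V k\<close> into
  \<open>V (Suc k)\<close>, so \<kappa>^2 times the integral is the series of \<open>K\<close>
  without its first term. The geometric bound justifies integrating termwise.\<close>

lemma marchenko_equation: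
  "K x z - \<kappa>\<^sup>2 * (LINT y|lborel. (if x < y then K x y * complex_of_real (W y z) else 0)) = \<kappa> * complex_of_real (W x z)"
proof -
  define f where "f k y = (if x < y then \<kappa> * ((\<kappa>\<^sup>2) ^ k * complex_of_real (V k x x y)) * complex_of_real (W y z) else 0)" for k y
  have f_le: "norm (f k y) \<le> (cmod \<kappa> * ((cmod \<kappa>)\<^sup>2) ^ k * (g x * g z)) * (g y)\<^sup>2" for k y
  proof -
    have "norm (f k y) \<le> (cmod \<kappa> * (((cmod \<kappa>)\<^sup>2) ^ k * (g x * g y))) * (g y * g z)"
      unfolding f_def using W_le[of y z] K_term_le[of k x x y]
      by (auto simp: norm_mult[of "_ * _"] norm_mult[of \<kappa>] g_nonneg simp del: norm_mult intro!: mult_mono)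
    then show ?thesis by (simp add: algebra_simps power2_eq_square)
  qed
  have [measurable]: "f k \<in> borel_measurable borel" for k unfolding f_def by measurable
  have int: "integrable lborel (f k)" for k using f_le by (intro dominated_integrable) auto
  have "(\<lambda>k. LINT y|lborel. f k y) sums (LINT y|lborel. (\<Sum>k. f k y))"
  proof (rule sums_integral[OF int])
    show "AE y in lborel. summable (\<lambda>k. norm (f k y))"
    proof (intro always_eventually allI)
      fix y show "summable (\<lambda>k. norm (f k y))"
        by (rule summable_comparison_test'[of "\<lambda>k. (cmod \<kappa> * ((cmod \<kappa>)\<^sup>2) ^ k * (g x * g z)) * (g y)\<^sup>2" 0])
           (use f_le geometric_summable in \<open>auto intro!: summable_mult2 summable_mult\<close>)
    qed
    have "norm (LINT y|lborel. norm (f k y)) \<le> cmod \<kappa> * ((cmod \<kappa>)\<^sup>2) ^ k * (g x * g z)" for k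
      using f_le by (intro dominated_integral_le) (auto simp: g_nonneg)
    then show "summable (\<lambda>k. LINT y|lborel. norm (f k y))"
      by (rule_tac summable_comparison_test'[of "\<lambda>k. cmod \<kappa> * ((cmod \<kappa>)\<^sup>2) ^ k * (g x * g z)" 0])
         (use geometric_summable in \<open>auto intro!: summable_mult2 summable_mult\<close>)
  qed
  moreover have "(\<Sum>k. f k y) = (if x < y then K x y * complex_of_real (W y z) else 0)" for y
  proof (cases "x < y")
    case True
    have "(\<lambda>k. \<kappa> * ((\<kappa>\<^sup>2) ^ k * complex_of_real (V k x x y)) * complex_of_real (W y z)) sums (K x y * complex_of_real (W y z))"
      unfolding K_def by (intro sums_mult sums_mult2 summable_sums K_term_summable)
    then show ?thesis using True by (simp add: f_def sums_iff)
  qed (simp add: f_def)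
  moreover have "(LINT y|lborel. f k y) = \<kappa> * ((\<kappa>\<^sup>2) ^ k * complex_of_real (V (Suc k) x x z))" for k
  proof -
    have "(LINT y|lborel. f k y) = (LINT y|lborel. (\<kappa> * (\<kappa>\<^sup>2) ^ k) * complex_of_real (if x < y then V k x x y * V 0 x y z else 0))"
      unfolding f_def by (intro Bochner_Integration.integral_cong refl) auto
    also have "\<dots> = (\<kappa> * (\<kappa>\<^sup>2) ^ k) * complex_of_real (V (Suc (k + 0)) x x z)"
      unfolding V_Suc_add by (simp only: integral_mult_right_zero integral_complex_of_real)
    finally show ?thesis by simp
  qed
  ultimately have "(\<lambda>k. \<kappa> * ((\<kappa>\<^sup>2) ^ k * complex_of_real (V (Suc k) x x z))) sums
      (LINT y|lborel. (if x < y then K x y * complex_of_real (W y z) else 0))" by simp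
  then have "(\<lambda>k. \<kappa>\<^sup>2 * (\<kappa> * ((\<kappa>\<^sup>2) ^ k * complex_of_real (V (Suc k) x x z)))) sums
      (\<kappa>\<^sup>2 * (LINT y|lborel. (if x < y then K x y * complex_of_real (W y z) else 0)))" by (rule sums_mult)
  then have "(\<lambda>k. \<kappa> * ((\<kappa>\<^sup>2) ^ Suc k * complex_of_real (V (Suc k) x x z))) sums
      (\<kappa>\<^sup>2 * (LINT y|lborel. (if x < y then K x y * complex_of_real (W y z) else 0)))"
    by (simp add: algebra_simps)
  moreover have "(\<lambda>k. \<kappa> * ((\<kappa>\<^sup>2) ^ k * complex_of_real (V k x x z))) sums K x z"
    unfolding K_def by (intro sums_mult summable_sums K_term_summable)
  then have "(\<lambda>k. \<kappa> * ((\<kappa>\<^sup>2) ^ Suc k * complex_of_real (V (Suc k) x x z))) sums (K x z - \<kappa> * complex_of_real (W x z))"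
    by (subst sums_Suc_iff) simp
  ultimately have "\<kappa>\<^sup>2 * (LINT y|lborel. (if x < y then K x y * complex_of_real (W y z) else 0)) = K x z - \<kappa> * complex_of_real (W x z)"
    by (rule sums_unique2)
  then show ?thesis by (simp add: algebra_simps)
qed

section \<open>The determinant of the truncated operator\<close>

definition truncated :: "real \<Rightarrow> real \<Rightarrow> real \<Rightarrow> complex" where
  "truncated s y z = - (\<kappa>\<^sup>2) * (indicator {s<..} y * complex_of_real (W y z) * indicator {s<..} z)"

lemma integral_half_line:
  fixes f :: "real \<Rightarrow> complex"
  assumes "0 \<le> s" "\<And>y. \<not> s < y \<Longrightarrow> f y = 0"
  shows "(LINT y|restrict_space lborel {0<..}. f y) = (LINT y|lborel. f y)"
  using assms by (subst integral_restrict_space) (auto intro!: Bochner_Integration.integral_cong simp: indicator_def)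

text \<open>The factor |\<kappa>|^2 is shared equally between the two arguments, so that the mass of
  the weight is at most |\<kappa>|^2 and hence below 1.\<close>

lemma dominated_truncated:
  "dominated_kernel (restrict_space lborel {0<..}) (truncated s) (\<lambda>u. cmod \<kappa> * g u)"
proof -
  interpret sigma_finite_measure "restrict_space lborel {0::real<..}"
    by (rule sigma_finite_measure_restrict_space[OF sigma_finite_lborel]) simp
  have id: "(\<lambda>x. x) \<in> measurable (restrict_space lborel {0::real<..}) borel"
    by (intro measurable_restrict_space1) simp
  show ?thesis
  proof
    have [measurable]: "fst \<in> measurable (restrict_space lborel {0::real<..} \<Otimes>\<^sub>M restrict_space lborel {0::real<..}) borel"
      "snd \<in> measurable (restrict_space lborel {0::real<..} \<Otimes>\<^sub>M restrict_space lborel {0::real<..}) borel"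
      using measurable_compose[OF measurable_fst id] measurable_compose[OF measurable_snd id] by auto
    show "(\<lambda>(u, v). truncated s u v) \<in> borel_measurable (restrict_space lborel {0<..} \<Otimes>\<^sub>M restrict_space lborel {0<..})"
      unfolding truncated_def split_beta by measurable
    show "(\<lambda>u. cmod \<kappa> * g u) \<in> borel_measurable (restrict_space lborel {0<..})"
      by (intro measurable_restrict_space1) simp
    show "0 \<le> cmod \<kappa> * g u" for u by (simp add: g_nonneg)
    have "integrable lborel (\<lambda>u. indicator {0<..} u *\<^sub>R (cmod \<kappa> * g u)\<^sup>2)"
      by (rule dominated_integrable[where C = "(cmod \<kappa>)\<^sup>2"]) (auto simp: indicator_def power_mult_distrib)
    then show "integrable (restrict_space lborel {0<..}) (\<lambda>u. (cmod \<kappa> * g u)\<^sup>2)"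
      by (subst integrable_restrict_space) simp_all
    show "norm (truncated s u v) \<le> cmod \<kappa> * g u * (cmod \<kappa> * g v)" for u v
    proof -
      have "norm (truncated s u v) \<le> (cmod \<kappa>)\<^sup>2 * \<bar>W u v\<bar>"
        by (auto simp: truncated_def norm_mult norm_power indicator_def)
      also have "\<dots> \<le> (cmod \<kappa>)\<^sup>2 * (g u * g v)" by (intro mult_left_mono W_le) auto
      finally show ?thesis by (simp add: algebra_simps power2_eq_square)
    qed
  qed
qed

lemma fredholm_det_truncated:
  assumes s: "0 < s"
  shows "fredholm_det (truncated s) =
    exp (- (\<Sum>k. \<kappa>\<^sup>2 * (\<kappa>\<^sup>2) ^ k * complex_of_real (LINT t|lborel. (if s < t then V k t t t else 0))))"
proof -
  interpret T: dominated_kernel "restrict_space lborel {0<..}" "truncated s" "\<lambda>u. cmod \<kappa> * g u"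
    by (rule dominated_truncated)
  have "T.mass = (LINT u|lborel. indicator {0<..} u *\<^sub>R (cmod \<kappa> * g u)\<^sup>2)"
    unfolding T.mass_def by (subst integral_restrict_space) auto
  also have "norm \<dots> \<le> (cmod \<kappa>)\<^sup>2"
    by (rule dominated_integral_le) (auto simp: indicator_def power_mult_distrib)
  finally have mass: "T.mass < 1" using coupling_sq by simp
  \<comment> \<open>The inner indicators become the cut-off of \<open>V\<close>, while the two outer
    ones survive as the condition on \<open>u\<close> and \<open>v\<close>.\<close>
  have kpow: "T.kpow k u v = (- \<kappa>\<^sup>2) ^ Suc k * complex_of_real (if s < u \<and> s < v then V k s u v else 0)" for k u v
  proof (induction k arbitrary: u v)
    case 0
    then show ?case unfolding T.kpow.simps by (auto simp: truncated_def)
  next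
    case (Suc k)
    have "T.kpow (Suc k) u v = (LINT y|restrict_space lborel {0<..}. truncated s u y *
        ((- \<kappa>\<^sup>2) ^ Suc k * complex_of_real (if s < y \<and> s < v then V k s y v else 0)))"
      unfolding T.kpow.simps Suc ..
    also have "\<dots> = (LINT y|lborel. truncated s u y *
        ((- \<kappa>\<^sup>2) ^ Suc k * complex_of_real (if s < y \<and> s < v then V k s y v else 0)))"
      using s by (intro integral_half_line[of s]) auto
    also have "\<dots> = (LINT y|lborel. (- \<kappa>\<^sup>2) ^ Suc (Suc k) * complex_of_real
        (if s < u \<and> s < v then if s < y then W u y * V k s y v else 0 else 0))"
      by (intro Bochner_Integration.integral_cong refl) (auto simp: truncated_def)
    also have "\<dots> = (- \<kappa>\<^sup>2) ^ Suc (Suc k) * complex_of_real (if s < u \<and> s < v then V (Suc k) s u v else 0)"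
      by (simp only: integral_mult_right_zero integral_complex_of_real) (cases "s < u \<and> s < v"; auto)
    finally show ?case .
  qed
  have ktrace: "T.ktrace k = (- \<kappa>\<^sup>2) ^ Suc k * complex_of_real (real (Suc k) * (LINT t|lborel. (if s < t then V k t t t else 0)))" for k
  proof -
    have "T.ktrace k = (LINT y|lborel. T.kpow k y y)"
      unfolding T.ktrace_def using s by (intro integral_half_line[of s]) (auto simp: kpow)
    also have "\<dots> = (- \<kappa>\<^sup>2) ^ Suc k * complex_of_real (LINT y|lborel. (if s < y then V k s y y else 0))"
      unfolding kpow by (simp only: integral_mult_right_zero integral_complex_of_real) simp
    finally show ?thesis by (simp only: trace_V)
  qed
  have tm: "(-1) ^ k * T.ktrace k / of_nat (Suc k) = - (\<kappa>\<^sup>2 * (\<kappa>\<^sup>2) ^ k * complex_of_real (LINT t|lborel. (if s < t then V k t t t else 0)))" for k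
  proof -
    \<comment> \<open>The alternating signs of the logarithmic series cancel against those of the
      powers of - \<kappa>^2, leaving a single minus sign.\<close>
    have "(-1) ^ k * (- \<kappa>\<^sup>2) ^ Suc k = - ((\<kappa>\<^sup>2) ^ Suc k)"
      by (simp add: power_mult_distrib[symmetric])
    then have "(-1) ^ k * T.ktrace k = - ((\<kappa>\<^sup>2) ^ Suc k) * complex_of_real (real (Suc k) * (LINT t|lborel. (if s < t then V k t t t else 0)))"
      unfolding ktrace mult.assoc[symmetric] by simp
    then show ?thesis by (simp del: of_nat_Suc)
  qed
  have le: "norm (\<kappa>\<^sup>2 * (\<kappa>\<^sup>2) ^ k * complex_of_real (LINT t|lborel. (if s < t then V k t t t else 0))) \<le> ((cmod \<kappa>)\<^sup>2) ^ k" for k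
  proof -
    have "norm (LINT t|lborel. (if s < t then V k t t t else 0)) \<le> 1"
      using V_le by (intro dominated_integral_le) (auto simp: power2_eq_square)
    then have "norm (\<kappa>\<^sup>2 * (\<kappa>\<^sup>2) ^ k * complex_of_real (LINT t|lborel. (if s < t then V k t t t else 0))) \<le> 1 * ((cmod \<kappa>)\<^sup>2) ^ k * 1"
      unfolding norm_mult norm_power using coupling_sq by (intro mult_mono) auto
    then show ?thesis by simp
  qed
  have "summable (\<lambda>k. \<kappa>\<^sup>2 * (\<kappa>\<^sup>2) ^ k * complex_of_real (LINT t|lborel. (if s < t then V k t t t else 0)))"
    by (rule summable_comparison_test'[OF geometric_summable le])
  then show ?thesis
    unfolding fredholm_det_eq_exp[OF dominated_truncated mass] tm by (simp add: suminf_minus)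
qed

text \<open>Since \<open>g\<close> need not be bounded near 0, the series converges uniformly only
  locally; the compact neighbourhood from x / 2 to 2 x is enough for the Weierstrass test.\<close>

lemma K_diagonal_continuous: "continuous_on {0<..} (\<lambda>t. K t t)"
proof (subst continuous_on_eq_continuous_at)
  show "\<forall>x\<in>{0<..}. isCont (\<lambda>t. K t t) x"
  proof
    fix x :: real assume x: "x \<in> {0<..}"
    have "compact (g ` {x/2..2*x})"
      using x by (intro compact_continuous_image continuous_on_subset[OF g_continuous]) auto
    then obtain B where B: "\<And>t. t \<in> {x/2..2*x} \<Longrightarrow> g t \<le> B"
      by (meson bounded_imp_bdd_above compact_imp_bounded bdd_above.unfold imageI)
    have "uniform_limit {x/2..2*x} (\<lambda>n t. \<Sum>k<n. (\<kappa>\<^sup>2) ^ k * complex_of_real (V k t t t))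
        (\<lambda>t. \<Sum>k. (\<kappa>\<^sup>2) ^ k * complex_of_real (V k t t t)) sequentially"
    proof (rule Weierstrass_m_test)
      show "summable (\<lambda>k. ((cmod \<kappa>)\<^sup>2) ^ k * (B * B))" by (intro summable_mult2 geometric_summable)
      fix k t assume t: "t \<in> {x/2..2*x}"
      have "norm ((\<kappa>\<^sup>2) ^ k * complex_of_real (V k t t t)) \<le> ((cmod \<kappa>)\<^sup>2) ^ k * (g t * g t)"
        by (rule K_term_le)
      also have "\<dots> \<le> ((cmod \<kappa>)\<^sup>2) ^ k * (B * B)"
        using B[OF t] g_nonneg[of t] by (intro mult_left_mono mult_mono) auto
      finally show "norm ((\<kappa>\<^sup>2) ^ k * complex_of_real (V k t t t)) \<le> ((cmod \<kappa>)\<^sup>2) ^ k * (B * B)" .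
    qed
    then have "continuous_on {x/2..2*x} (\<lambda>t. \<Sum>k. (\<kappa>\<^sup>2) ^ k * complex_of_real (V k t t t))"
    proof (rule uniform_limit_theorem[rotated])
      show "\<forall>\<^sub>F n in sequentially. continuous_on {x/2..2*x} (\<lambda>t. \<Sum>k<n. (\<kappa>\<^sup>2) ^ k * complex_of_real (V k t t t))"
        using x by (intro always_eventually allI continuous_on_sum continuous_on_mult continuous_on_const
          continuous_on_of_real continuous_on_subset[OF V_diagonal_continuous]) auto
    qed simp
    then have "continuous_on {x/2..2*x} (\<lambda>t. K t t)" unfolding K_def by (intro continuous_intros)
    moreover have "x \<in> interior {x/2..2*x}" using x by (simp add: interior_atLeastAtMost_real)
    ultimately show "isCont (\<lambda>t. K t t) x" by (rule continuous_on_interior)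
  qed
qed simp

lemma K_diagonal_integrable: "integrable lborel (\<lambda>t. if s < t then \<kappa> * K t t else 0)"
proof (rule dominated_integrable[where C = K_bound])
  fix t
  have "norm (\<kappa> * K t t) \<le> 1 * (K_bound * (g t * g t))"
    unfolding norm_mult using coupling by (intro mult_mono K_le) auto
  then show "norm (if s < t then \<kappa> * K t t else 0) \<le> K_bound * (g t)\<^sup>2"
    using K_bound_nonneg by (auto simp: power2_eq_square)
qed measurable

text \<open>The sum and the integral are exchanged by the bound |\<kappa>|^(2 k)
  \<open>(g t)\<^sup>2\<close>. Being an exponential, the determinant has no zeros, so its
  logarithmic derivative makes sense.\<close>

lemma fredholm_det_truncated_eq_exp_integral:
  assumes "0 < s"
  shows "fredholm_det (truncated s) = exp (- (LINT t|lborel. (if s < t then \<kappa> * K t t else 0)))"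
proof -
  define f where "f k t = \<kappa>\<^sup>2 * (\<kappa>\<^sup>2) ^ k * complex_of_real (if s < t then V k t t t else 0)" for k t
  have f_le: "norm (f k t) \<le> ((cmod \<kappa>)\<^sup>2) ^ k * (g t)\<^sup>2" for k t
  proof -
    have "norm (f k t) \<le> 1 * ((cmod \<kappa>)\<^sup>2) ^ k * (g t)\<^sup>2"
      unfolding f_def norm_mult norm_power using coupling_sq V_le[of k t t t]
      by (intro mult_mono) (auto simp: power2_eq_square)
    then show ?thesis by simp
  qed
  have [measurable]: "f k \<in> borel_measurable borel" for k unfolding f_def by measurable
  have int: "integrable lborel (f k)" for k using f_le by (intro dominated_integrable) auto
  have "(\<lambda>k. LINT t|lborel. f k t) sums (LINT t|lborel. (\<Sum>k. f k t))"
  proof (rule sums_integral[OF int])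
    show "AE t in lborel. summable (\<lambda>k. norm (f k t))"
    proof (intro always_eventually allI)
      fix t show "summable (\<lambda>k. norm (f k t))"
        by (rule summable_comparison_test'[of "\<lambda>k. ((cmod \<kappa>)\<^sup>2) ^ k * (g t)\<^sup>2" 0])
           (use f_le geometric_summable in \<open>auto intro!: summable_mult2\<close>)
    qed
    have "norm (LINT t|lborel. norm (f k t)) \<le> ((cmod \<kappa>)\<^sup>2) ^ k" for k
      using f_le by (intro dominated_integral_le) auto
    then show "summable (\<lambda>k. LINT t|lborel. norm (f k t))"
      by (rule_tac summable_comparison_test'[OF geometric_summable, of 0]) auto
  qed
  moreover have "(\<Sum>k. f k t) = (if s < t then \<kappa> * K t t else 0)" for t
    unfolding f_def K_def using K_term_summable[of t t t]
    by (simp add: suminf_mult mult.assoc power2_eq_square[of \<kappa>])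
  moreover have "(LINT t|lborel. f k t) = \<kappa>\<^sup>2 * (\<kappa>\<^sup>2) ^ k * complex_of_real (LINT t|lborel. (if s < t then V k t t t else 0))" for k
    unfolding f_def by (simp only: integral_mult_right_zero integral_complex_of_real)
  ultimately show ?thesis unfolding fredholm_det_truncated[OF assms] by (simp add: sums_iff)
qed

lemma fredholm_det_truncated_derivative:
  assumes x: "0 < x"
  shows "((\<lambda>s. fredholm_det (truncated s)) has_vector_derivative \<kappa> * K x x * fredholm_det (truncated x)) (at x)"
proof -
  define L where "L s = (LINT t|lborel. (if s < t then \<kappa> * K t t else 0))" for s
  \<comment> \<open>Any base point in (0, x) would do. It replaces the integral to infinity by a
    constant minus an integral over a compact interval, to which the fundamental theorem of calculus
    applies.\<close>
  define a where "a = x / 2"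
  have a: "0 < a" "a < x" using x by (auto simp: a_def)
  have cont: "continuous_on {a..2*x} (\<lambda>t. \<kappa> * K t t)"
    using a by (intro continuous_intros continuous_on_subset[OF K_diagonal_continuous]) auto
  have L_eq: "L s = L a - integral {a..s} (\<lambda>t. \<kappa> * K t t)" if s: "s \<in> {a<..<2*x}" for s
  proof -
    have int: "set_integrable lborel {a..s} (\<lambda>t. \<kappa> * K t t)"
      using s by (intro borel_integrable_atLeastAtMost' continuous_on_subset[OF cont]) auto
    have "L a = (LINT t|lborel. indicator {a..s} t *\<^sub>R (\<kappa> * K t t) + (if s < t then \<kappa> * K t t else 0))"
      unfolding L_def
    proof (rule integral_cong_AE)
      show "AE t in lborel. (if a < t then \<kappa> * K t t else 0) = indicator {a..s} t *\<^sub>R (\<kappa> * K t t) + (if s < t then \<kappa> * K t t else 0)"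
        using AE_lborel_singleton[of a] by eventually_elim (use s in \<open>auto simp: indicator_def\<close>)
    qed measurable
    also have "\<dots> = (LINT t:{a..s}|lborel. \<kappa> * K t t) + L s"
      unfolding L_def set_lebesgue_integral_def
      by (intro Bochner_Integration.integral_add K_diagonal_integrable int[unfolded set_integrable_def])
    also have "(LINT t:{a..s}|lborel. \<kappa> * K t t) = integral {a..s} (\<lambda>t. \<kappa> * K t t)"
      using int by (rule set_borel_integral_eq_integral)
    finally show ?thesis by simp
  qed
  have "((\<lambda>s. integral {a..s} (\<lambda>t. \<kappa> * K t t)) has_vector_derivative \<kappa> * K x x) (at x within {a..2*x})"
    using a by (intro integral_has_vector_derivative cont) auto
  then have "((\<lambda>s. integral {a..s} (\<lambda>t. \<kappa> * K t t)) has_vector_derivative \<kappa> * K x x) (at x)"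
    using a by (subst (asm) at_within_Icc_at) auto
  note D = has_vector_derivative_diff[OF has_vector_derivative_const[of "L a"] this]
  have "(L has_vector_derivative 0 - \<kappa> * K x x) (at x)"
  proof (rule has_vector_derivative_transform_within_open[OF D])
    show "L a - integral {a..s} (\<lambda>t. \<kappa> * K t t) = L s" if "s \<in> {a<..<2*x}" for s
      using L_eq[OF that] by (rule sym)
  qed (use a in auto)
  from has_vector_derivative_minus[OF this]
  have "((\<lambda>s. - L s) has_vector_derivative \<kappa> * K x x) (at x)" by simp
  then have "((exp \<circ> (\<lambda>s. - L s)) has_vector_derivative (\<kappa> * K x x) * exp (- L x)) (at x)"
    by (rule field_vector_diff_chain_at) (rule DERIV_exp)
  then have E: "((\<lambda>s. exp (- L s)) has_vector_derivative \<kappa> * K x x * exp (- L x)) (at x)"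
    by (simp add: o_def)
  have "((\<lambda>s. fredholm_det (truncated s)) has_vector_derivative \<kappa> * K x x * exp (- L x)) (at x)"
  proof (rule has_vector_derivative_transform_within_open[OF E])
    show "exp (- L s) = fredholm_det (truncated s)" if "s \<in> {0<..}" for s
      using that by (simp add: L_def fredholm_det_truncated_eq_exp_integral)
  qed (use x in auto)
  then show ?thesis using x by (simp add: L_def fredholm_det_truncated_eq_exp_integral)
qed

end

section \<open>Nuclear expansions\<close>

text \<open>An expansion of Mercer type, at every point but without eigenfunctions or orthogonality.
  Exactness of \<open>g\<close> on the diagonal makes \<open>(g u)\<^sup>2\<close> the sum of the
  \<open>(a n u)\<^sup>2\<close>.\<close>

locale marchenko_expansion = marchenko_coupling +
  fixes a :: "nat \<Rightarrow> real \<Rightarrow> real"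
  assumes a_measurable [measurable]: "a n \<in> borel_measurable borel"
    and a_sums: "(\<lambda>n. a n u * a n v) sums W u v"
    and W_diagonal: "W u u = (g u)\<^sup>2"
begin

lemma partial_sum_square_le: "(\<Sum>n<N. (a n u)\<^sup>2) \<le> (g u)\<^sup>2"
proof -
  have "(\<lambda>n. (a n u)\<^sup>2) sums (g u)\<^sup>2" using a_sums[of u u] by (simp add: W_diagonal power2_eq_square)
  then show ?thesis using sum_le_suminf[of "\<lambda>n. (a n u)\<^sup>2" "{..<N}"] by (simp add: sums_iff)
qed

text \<open>Independent of \<open>N\<close>, hence a dominating function for passing to the limit in
  integrals of the partial sums.\<close>

lemma partial_sum_le: "\<bar>\<Sum>n<N. a n u * a n v\<bar> \<le> g u * g v"
proof -
  have "(\<Sum>n<N. a n u * a n v)\<^sup>2 \<le> (\<Sum>n<N. (a n u)\<^sup>2) * (\<Sum>n<N. (a n v)\<^sup>2)"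
    by (rule Cauchy_Schwarz_ineq_sum)
  also have "\<dots> \<le> (g u)\<^sup>2 * (g v)\<^sup>2"
    by (intro mult_mono partial_sum_square_le sum_nonneg) auto
  also have "\<dots> = (g u * g v)\<^sup>2" by (simp add: power_mult_distrib)
  finally show ?thesis using abs_le_square_iff[of "\<Sum>n<N. a n u * a n v" "g u * g v"]
    by (simp add: g_nonneg)
qed

lemma a_le: "\<bar>a n u\<bar> \<le> g u"
proof -
  have "(a n u)\<^sup>2 \<le> (\<Sum>m<Suc n. (a m u)\<^sup>2)" by (rule member_le_sum) auto
  also have "\<dots> \<le> (g u)\<^sup>2" by (rule partial_sum_square_le)
  finally show ?thesis using abs_le_square_iff[of "a n u" "g u"] by (simp add: g_nonneg)
qed

lemma a_square_integrable: "integrable lborel (\<lambda>u. (a n u)\<^sup>2)"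
  using abs_le_square_iff[THEN iffD1, OF order_trans[OF a_le abs_ge_self]]
  by (intro dominated_integrable[where C = 1]) auto

definition \<alpha> :: "nat \<Rightarrow> real" where
  "\<alpha> n = sqrt (LINT u|lborel. (a n u)\<^sup>2)"

lemma \<alpha>_nonneg: "0 \<le> \<alpha> n" by (simp add: \<alpha>_def)

lemma \<alpha>_square: "(\<alpha> n)\<^sup>2 = (LINT u|lborel. (a n u)\<^sup>2)" by (simp add: \<alpha>_def)

text \<open>The squared norms add up to at most the integral of the diagonal of \<open>W\<close>,
  its trace.\<close>

lemma summable_\<alpha>: "summable (\<lambda>n. (\<alpha> n)\<^sup>2)"
proof (rule bounded_imp_summable)
  fix N
  have "(\<Sum>n\<le>N. (\<alpha> n)\<^sup>2) = (LINT u|lborel. (\<Sum>n<Suc N. (a n u)\<^sup>2))"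
    unfolding \<alpha>_square using a_square_integrable
    by (subst Bochner_Integration.integral_sum) (auto simp: lessThan_Suc_atMost)
  also have "\<dots> \<le> (LINT u|lborel. (g u)\<^sup>2)"
    by (intro integral_mono partial_sum_square_le g_integrable Bochner_Integration.integrable_sum a_square_integrable)
  also note g_mass
  finally show "(\<Sum>n\<le>N. (\<alpha> n)\<^sup>2) \<le> 1" .
qed auto

lemma L2_dominated:
  fixes f :: "real \<Rightarrow> complex"
  assumes f [measurable]: "f \<in> borel_measurable borel"
    and int: "integrable lborel h" and le: "\<And>x. (cmod (f x))\<^sup>2 \<le> h x"
  shows "L2_pos f" "L2_norm_pos f \<le> sqrt (LINT x|lborel. h x)"
proof -
  have h0: "0 \<le> h x" for x by (rule order_trans[OF _ le]) simp
  have i: "integrable lborel (\<lambda>x. indicator {0<..} x *\<^sub>R (cmod (f x))\<^sup>2)"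
    using le h0 by (intro Bochner_Integration.integrable_bound[OF int]) (auto simp: indicator_def)
  then show "L2_pos f" by (simp add: L2_pos_def set_integrable_def set_borel_measurable_def)
  have "(LINT x:{0<..}|lborel. (cmod (f x))\<^sup>2) \<le> (LINT x|lborel. h x)"
    unfolding set_lebesgue_integral_def using le h0
    by (intro integral_mono i int) (auto simp: indicator_def)
  then show "L2_norm_pos f \<le> sqrt (LINT x|lborel. h x)"
    unfolding L2_norm_pos_def by simp
qed

lemma L2_a: "L2_pos (\<lambda>u. complex_of_real (a n u))" "L2_norm_pos (\<lambda>u. complex_of_real (a n u)) \<le> \<alpha> n"
  unfolding \<alpha>_def by (rule L2_dominated[OF _ a_square_integrable[of n]]; simp)+

lemma L2_norm_pos_nonneg: "0 \<le> L2_norm_pos f"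
  unfolding L2_norm_pos_def set_lebesgue_integral_def by simp

text \<open>The second factors are always the \<open>a n\<close>. If the norms of the first factors
  are at most \<open>C * \<alpha> n\<close>, the products of norms are at most
  \<open>C * (\<alpha> n)\<^sup>2\<close>, which is summable. This serves \<open>W\<close> with the
  \<open>a n\<close> themselves and \<open>K\<close> with the functions \<open>b n\<close>.\<close>

lemma trace_class_kernelI:
  assumes b [measurable]: "\<And>n. b n \<in> borel_measurable borel"
    and int: "\<And>n. integrable lborel (h n)" and le: "\<And>n x. (cmod (b n x))\<^sup>2 \<le> h n x"
    and h: "\<And>n. (LINT x|lborel. h n x) \<le> (C * \<alpha> n)\<^sup>2" and C: "0 \<le> C"
    and sums: "\<And>x z. (\<lambda>n. b n x * complex_of_real (a n z)) sums T x z"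
  shows "trace_class_kernel T"
  unfolding trace_class_kernel_def
proof (intro exI conjI allI)
  show "L2_pos (b n)" for n using le by (intro L2_dominated(1)[OF _ int]) auto
  show "L2_pos (\<lambda>u. complex_of_real (a n u))" for n by (rule L2_a)
  have b_norm: "L2_norm_pos (b n) \<le> C * \<alpha> n" for n
  proof -
    have "L2_norm_pos (b n) \<le> sqrt (LINT x|lborel. h n x)" using le by (intro L2_dominated(2)[OF _ int]) auto
    also have "\<dots> \<le> sqrt ((C * \<alpha> n)\<^sup>2)" by (intro real_sqrt_le_mono h)
    also have "\<dots> = C * \<alpha> n" using C by (simp add: \<alpha>_nonneg)
    finally show ?thesis .
  qed
  show "summable (\<lambda>n. L2_norm_pos (b n) * L2_norm_pos (\<lambda>u. complex_of_real (a n u)))"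
  proof (rule summable_comparison_test')
    show "summable (\<lambda>n. C * (\<alpha> n)\<^sup>2)" by (intro summable_mult summable_\<alpha>)
    fix n :: nat
    have "L2_norm_pos (b n) * L2_norm_pos (\<lambda>u. complex_of_real (a n u)) \<le> (C * \<alpha> n) * \<alpha> n"
      by (intro mult_mono b_norm L2_a) (auto simp: C \<alpha>_nonneg L2_norm_pos_nonneg)
    then show "norm (L2_norm_pos (b n) * L2_norm_pos (\<lambda>u. complex_of_real (a n u))) \<le> C * (\<alpha> n)\<^sup>2"
      by (simp add: L2_norm_pos_nonneg power2_eq_square mult.assoc)
  qed
  show "AE p in lborel. p \<in> {0<..} \<times> {0<..} \<longrightarrow> (\<lambda>n. b n (fst p) * complex_of_real (a n (snd p))) sums T (fst p) (snd p)"
    using sums by simp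
qed

lemma trace_class_W: "trace_class_kernel (\<lambda>u v. complex_of_real (W u v))"
proof (rule trace_class_kernelI)
  show "integrable lborel (\<lambda>u. (a n u)\<^sup>2)" for n by (rule a_square_integrable)
  show "(\<lambda>n. complex_of_real (a n x) * complex_of_real (a n z)) sums complex_of_real (W x z)" for x z
    using sums_of_real[OF a_sums[of x z], where 'a = complex] by simp
  show "(LINT x|lborel. (a n x)\<^sup>2) \<le> (1 * \<alpha> n)\<^sup>2" for n by (simp add: \<alpha>_square)
qed auto

lemma K_a_le: "norm (if x < y then K x y * complex_of_real (a n y) else 0) \<le> (K_bound * g x) * (g y * \<bar>a n y\<bar>)"
proof -
  have "norm (K x y * complex_of_real (a n y)) \<le> (K_bound * (g x * g y)) * \<bar>a n y\<bar>"
    unfolding norm_mult by (intro mult_mono K_le) (auto simp: K_bound_nonneg g_nonneg)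
  then show ?thesis by (auto simp: K_bound_nonneg g_nonneg mult.assoc)
qed

lemma K_a_integrable: "integrable lborel (\<lambda>y. if x < y then K x y * complex_of_real (a n y) else 0)"
proof (rule dominated_integrable)
  fix y
  have "(K_bound * g x) * (g y * \<bar>a n y\<bar>) \<le> (K_bound * g x) * (g y * g y)"
    by (intro mult_left_mono a_le) (auto simp: K_bound_nonneg g_nonneg)
  with K_a_le[of x y n] show "norm (if x < y then K x y * complex_of_real (a n y) else 0) \<le> (K_bound * g x) * (g y)\<^sup>2"
    by (simp add: power2_eq_square)
qed measurable

text \<open>Insert the expansion of \<open>W\<close> into K = \<kappa> W + \<kappa>^2 (integral of K
  W) and collect what multiplies \<open>a n z\<close>; only \<open>W\<close>, not \<open>K\<close>,
  is expanded under the integral.\<close>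

definition b :: "nat \<Rightarrow> real \<Rightarrow> complex" where
  "b n x = \<kappa> * complex_of_real (a n x) + \<kappa>\<^sup>2 * (LINT y|lborel. (if x < y then K x y * complex_of_real (a n y) else 0))"

lemma b_measurable [measurable]: "b n \<in> borel_measurable borel"
  unfolding b_def by measurable

text \<open>Cauchy--Schwarz for \<open>g\<close> and \<open>a n\<close> bounds the integral term by
  \<open>K_bound * g x * \<alpha> n\<close>, which keeps the factor \<open>\<alpha> n\<close>; then
  (p + q)^2 \<le> 2 p^2 + 2 q^2.\<close>

lemma b_le: "(cmod (b n x))\<^sup>2 \<le> 2 * (a n x)\<^sup>2 + 2 * (K_bound * \<alpha> n)\<^sup>2 * (g x)\<^sup>2"
proof -
  have ga: "integrable lborel (\<lambda>y. g y * \<bar>a n y\<bar>)"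
    by (rule integrable_mult_of_square_integrable) (use g_integrable a_square_integrable in auto)
  have "norm (LINT y|lborel. (if x < y then K x y * complex_of_real (a n y) else 0))
      \<le> (LINT y|lborel. (K_bound * g x) * (g y * \<bar>a n y\<bar>))"
    by (intro norm_integral_le_dominated K_a_le integrable_mult_right ga)
  also have "\<dots> = (K_bound * g x) * (LINT y|lborel. g y * \<bar>a n y\<bar>)" by simp
  also have "\<dots> \<le> (K_bound * g x) * \<alpha> n"
  proof (rule mult_left_mono)
    have "\<bar>LINT y|lborel. g y * \<bar>a n y\<bar>\<bar> \<le> sqrt (LINT y|lborel. (g y)\<^sup>2) * sqrt (LINT y|lborel. \<bar>a n y\<bar>\<^sup>2)"
      by (rule Cauchy_Schwarz_integral) (use g_integrable a_square_integrable in auto)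
    also have "\<dots> \<le> 1 * \<alpha> n"
      unfolding \<alpha>_def using g_mass by (intro mult_mono) auto
    finally show "(LINT y|lborel. g y * \<bar>a n y\<bar>) \<le> \<alpha> n" by simp
  qed (simp add: K_bound_nonneg g_nonneg)
  finally have I: "norm (LINT y|lborel. (if x < y then K x y * complex_of_real (a n y) else 0)) \<le> K_bound * g x * \<alpha> n" .
  have "cmod (b n x) \<le> 1 * \<bar>a n x\<bar> + 1 * (K_bound * g x * \<alpha> n)"
    unfolding b_def using coupling coupling_sq I
    by (intro order_trans[OF norm_triangle_ineq] add_mono; unfold norm_mult norm_power norm_of_real; intro mult_mono) auto
  then have "(cmod (b n x))\<^sup>2 \<le> (\<bar>a n x\<bar> + K_bound * g x * \<alpha> n)\<^sup>2"
    by (intro power_mono) auto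
  also have "\<dots> \<le> 2 * \<bar>a n x\<bar>\<^sup>2 + 2 * (K_bound * g x * \<alpha> n)\<^sup>2"
    using sum_squares_bound[of "\<bar>a n x\<bar>" "K_bound * g x * \<alpha> n"] unfolding power2_sum by simp
  finally show ?thesis by (simp add: power_mult_distrib mult_ac)
qed

text \<open>Dominated convergence for the partial sums of the expansion of \<open>W\<close> under
  the integral, followed by the Marchenko equation.\<close>

lemma b_sums: "(\<lambda>n. b n x * complex_of_real (a n z)) sums K x z"
proof -
  let ?f = "\<lambda>y. if x < y then K x y * complex_of_real (W y z) else 0"
  let ?k = "\<lambda>n y. if x < y then K x y * complex_of_real (a n y) else 0"
  have "(\<lambda>N. LINT y|lborel. (\<Sum>n<N. ?k n y * complex_of_real (a n z))) \<longlonglongrightarrow> (LINT y|lborel. ?f y)"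
  proof (rule integral_dominated_convergence[where w = "\<lambda>y. (K_bound * (g x * g z)) * (g y)\<^sup>2"])
    show "integrable lborel (\<lambda>y. (K_bound * (g x * g z)) * (g y)\<^sup>2)"
      by (intro integrable_mult_right g_integrable)
    show "AE y in lborel. (\<lambda>N. \<Sum>n<N. ?k n y * complex_of_real (a n z)) \<longlonglongrightarrow> ?f y"
    proof (intro always_eventually allI)
      fix y
      have "(\<lambda>n. K x y * complex_of_real (a n y * a n z)) sums (K x y * complex_of_real (W y z))"
        by (intro sums_mult sums_of_real a_sums)
      then show "(\<lambda>N. \<Sum>n<N. ?k n y * complex_of_real (a n z)) \<longlonglongrightarrow> ?f y"
        by (auto simp: sums_def mult.assoc)
    qed
    show "AE y in lborel. norm (\<Sum>n<N. ?k n y * complex_of_real (a n z)) \<le> (K_bound * (g x * g z)) * (g y)\<^sup>2" for N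
    proof (intro always_eventually allI)
      fix y
      have "norm (K x y * complex_of_real (\<Sum>n<N. a n y * a n z)) \<le> (K_bound * (g x * g y)) * (g y * g z)"
        unfolding norm_mult norm_of_real using partial_sum_le
        by (intro mult_mono K_le) (auto simp: K_bound_nonneg g_nonneg)
      then show "norm (\<Sum>n<N. ?k n y * complex_of_real (a n z)) \<le> (K_bound * (g x * g z)) * (g y)\<^sup>2"
        by (cases "x < y") (auto simp: sum_distrib_left power2_eq_square mult_ac K_bound_nonneg g_nonneg)
    qed
  qed measurable
  also have "(\<lambda>N. LINT y|lborel. (\<Sum>n<N. ?k n y * complex_of_real (a n z)))
     = (\<lambda>N. \<Sum>n<N. (LINT y|lborel. ?k n y) * complex_of_real (a n z))"
    by (subst Bochner_Integration.integral_sum) (auto intro!: integrable_mult_left K_a_integrable)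
  finally have "(\<lambda>n. (LINT y|lborel. ?k n y) * complex_of_real (a n z)) sums (LINT y|lborel. ?f y)"
    unfolding sums_def .
  then have "(\<lambda>n. \<kappa> * complex_of_real (a n x * a n z) + \<kappa>\<^sup>2 * ((LINT y|lborel. ?k n y) * complex_of_real (a n z)))
      sums (\<kappa> * complex_of_real (W x z) + \<kappa>\<^sup>2 * (LINT y|lborel. ?f y))"
    by (intro sums_add sums_mult sums_of_real a_sums)
  moreover have "\<kappa> * complex_of_real (W x z) + \<kappa>\<^sup>2 * (LINT y|lborel. ?f y) = K x z"
    using marchenko_equation[of x z] by (simp add: algebra_simps)
  ultimately show ?thesis unfolding b_def by (simp add: algebra_simps)
qed

lemma trace_class_K: "trace_class_kernel K"
\<comment> \<open>The constant \<open>C\<close> comes from integrating \<open>b_le\<close>, the mass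
  of \<open>g\<^sup>2\<close> being at most 1.\<close>
proof (rule trace_class_kernelI[where b = b and h = "\<lambda>n x. 2 * (a n x)\<^sup>2 + 2 * (K_bound * \<alpha> n)\<^sup>2 * (g x)\<^sup>2"
      and C = "sqrt (2 + 2 * K_bound\<^sup>2)"])
  show "integrable lborel (\<lambda>x. 2 * (a n x)\<^sup>2 + 2 * (K_bound * \<alpha> n)\<^sup>2 * (g x)\<^sup>2)" for n
    by (intro Bochner_Integration.integrable_add integrable_mult_right a_square_integrable g_integrable)
  show "(LINT x|lborel. 2 * (a n x)\<^sup>2 + 2 * (K_bound * \<alpha> n)\<^sup>2 * (g x)\<^sup>2) \<le> (sqrt (2 + 2 * K_bound\<^sup>2) * \<alpha> n)\<^sup>2" for n
  proof -
    have "(LINT x|lborel. 2 * (a n x)\<^sup>2 + 2 * (K_bound * \<alpha> n)\<^sup>2 * (g x)\<^sup>2)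
      = 2 * (\<alpha> n)\<^sup>2 + 2 * (K_bound * \<alpha> n)\<^sup>2 * (LINT x|lborel. (g x)\<^sup>2)"
      using a_square_integrable[of n] g_integrable by (simp add: \<alpha>_square)
    also have "\<dots> \<le> 2 * (\<alpha> n)\<^sup>2 + 2 * (K_bound * \<alpha> n)\<^sup>2 * 1"
      by (intro add_left_mono mult_left_mono g_mass) auto
    also have "\<dots> = (sqrt (2 + 2 * K_bound\<^sup>2) * \<alpha> n)\<^sup>2"
      by (simp add: power_mult_distrib algebra_simps)
    finally show ?thesis .
  qed
qed (auto intro: b_le b_sums)

end

section \<open>The Haar system on the half-line\<close>

definition dyadic_cell :: "nat \<Rightarrow> nat \<Rightarrow> real set" where
  "dyadic_cell j k = {real k / 2 ^ j ..< real (Suc k) / 2 ^ j}"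

definition cell_integral :: "nat \<Rightarrow> nat \<Rightarrow> (real \<Rightarrow> real) \<Rightarrow> real" where
  "cell_integral j k f = (LINT t|lborel. indicator (dyadic_cell j k) t * f t)"

text \<open>Inner products with the orthonormal Haar system: level 0 has the indicators of unit
  intervals, level j + 1 the wavelets on the cells of length 2^(-j). The factor
  \<open>sqrt (2 ^ j)\<close> normalizes the wavelets.\<close>

fun haar_pair :: "nat \<Rightarrow> nat \<Rightarrow> (real \<Rightarrow> real) \<Rightarrow> real" where
  "haar_pair 0 k f = cell_integral 0 k f"
| "haar_pair (Suc j) k f =
     sqrt (2 ^ j) * (cell_integral (Suc j) (2 * k) f - cell_integral (Suc j) (Suc (2 * k)) f)"

definition haar :: "nat \<Rightarrow> (real \<Rightarrow> real) \<Rightarrow> real" where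
  "haar n f = haar_pair (fst (prod_decode n)) (snd (prod_decode n)) f"

text \<open>Continuity at every t > 0 gives pointwise convergence of the cell averages. The value 0
  elsewhere matches the dyadic cells, which cover only the half-line.\<close>

definition half_line_L2_cont :: "(real \<Rightarrow> real) \<Rightarrow> bool" where
  "half_line_L2_cont f \<longleftrightarrow> f \<in> borel_measurable borel \<and> integrable lborel (\<lambda>t. (f t)\<^sup>2)
     \<and> (\<forall>t\<le>0. f t = 0) \<and> (\<forall>t>0. isCont f t)"

lemma dyadic_cell_iff:
  "t \<in> dyadic_cell j k \<longleftrightarrow> 0 \<le> t \<and> k = nat \<lfloor>t * 2 ^ j\<rfloor>"
proof -
  have "t \<in> dyadic_cell j k \<longleftrightarrow> real k \<le> t * 2 ^ j \<and> t * 2 ^ j < real k + 1"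
    by (simp add: dyadic_cell_def field_simps)
  also have "\<dots> \<longleftrightarrow> \<lfloor>t * 2 ^ j\<rfloor> = int k" by (simp add: floor_eq_iff)
  also have "\<dots> \<longleftrightarrow> 0 \<le> t \<and> k = nat \<lfloor>t * 2 ^ j\<rfloor>"
  proof
    assume *: "\<lfloor>t * 2 ^ j\<rfloor> = int k"
    then have "0 \<le> \<lfloor>t * 2 ^ j\<rfloor>" by simp
    then have "0 \<le> t * 2 ^ j" by simp
    then have "0 \<le> t" using mult_neg_pos[of t "2 ^ j"] by (cases "t < 0") auto
    then show "0 \<le> t \<and> k = nat \<lfloor>t * 2 ^ j\<rfloor>" using * by simp
  next
    assume *: "0 \<le> t \<and> k = nat \<lfloor>t * 2 ^ j\<rfloor>"
    then have "0 \<le> \<lfloor>t * 2 ^ j\<rfloor>" by simp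
    then show "\<lfloor>t * 2 ^ j\<rfloor> = int k" using * by simp
  qed
  finally show ?thesis .
qed

lemma disjoint_dyadic_cell: "disjoint_family (dyadic_cell j)"
  by (auto simp: disjoint_family_on_def dyadic_cell_iff)

lemma UN_dyadic_cell: "(\<Union>k. dyadic_cell j k) = {0..}"
  by (auto simp: dyadic_cell_iff)

lemma dyadic_cell_sets [measurable]: "dyadic_cell j k \<in> sets borel"
  unfolding dyadic_cell_def by simp

lemma emeasure_dyadic_cell: "emeasure lborel (dyadic_cell j k) = ennreal (1 / 2 ^ j)"
  unfolding dyadic_cell_def by (simp add: divide_right_mono field_simps)

lemma measure_dyadic_cell [simp]: "measure lborel (dyadic_cell j k) = 1 / 2 ^ j"
  by (simp add: measure_def emeasure_dyadic_cell)

lemma integral_indicator_dyadic_cell: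
  "integrable lborel (indicator (dyadic_cell j k) :: real \<Rightarrow> real)"
  "(LINT t|lborel. indicator (dyadic_cell j k) t) = (1 / 2 ^ j :: real)"
  by (simp_all add: integrable_indicator_iff emeasure_dyadic_cell)

lemma indicator_dyadic_cell_split:
  "indicator (dyadic_cell j k) t =
   indicator (dyadic_cell (Suc j) (2 * k)) t + (indicator (dyadic_cell (Suc j) (Suc (2 * k))) t :: real)"
proof -
  have "real (2 * k) / 2 ^ Suc j = real k / 2 ^ j" "real (Suc (Suc (2 * k))) / 2 ^ Suc j = real (Suc k) / 2 ^ j"
    by (auto simp: field_simps)
  moreover have "real k / 2 ^ j \<le> real (Suc (2 * k)) / 2 ^ Suc j" "real (Suc (2 * k)) / 2 ^ Suc j \<le> real (Suc k) / 2 ^ j"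
    by (auto simp: field_simps)
  ultimately show ?thesis
    unfolding dyadic_cell_def by (auto simp: indicator_def simp del: power_Suc of_nat_Suc)
qed

lemma half_line_L2_cont_lincomb:
  assumes f: "half_line_L2_cont f" and h: "half_line_L2_cont h"
  shows "half_line_L2_cont (\<lambda>t. f t + c * h t)"
proof -
  have [measurable]: "f \<in> borel_measurable borel" "h \<in> borel_measurable borel"
    using f h by (auto simp: half_line_L2_cont_def)
  have fh: "integrable lborel (\<lambda>t. f t * h t)"
    using f h by (intro integrable_mult_of_square_integrable) (auto simp: half_line_L2_cont_def)
  have "integrable lborel (\<lambda>t. (f t)\<^sup>2 + 2 * c * (f t * h t) + c\<^sup>2 * (h t)\<^sup>2)"
    using f h fh by (auto simp: half_line_L2_cont_def)
  also have "(\<lambda>t. (f t)\<^sup>2 + 2 * c * (f t * h t) + c\<^sup>2 * (h t)\<^sup>2) = (\<lambda>t. (f t + c * h t)\<^sup>2)"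
    by (auto simp: power2_eq_square algebra_simps)
  finally show ?thesis using f h by (auto simp: half_line_L2_cont_def)
qed

lemma cell_integrable:
  assumes "half_line_L2_cont f"
  shows "integrable lborel (\<lambda>t. indicator (dyadic_cell j k) t * f t)"
proof (rule integrable_mult_of_square_integrable)
  have "(\<lambda>t. (indicator (dyadic_cell j k) t :: real)\<^sup>2) = indicator (dyadic_cell j k)"
    by (auto simp: indicator_def)
  then show "integrable lborel (\<lambda>t. (indicator (dyadic_cell j k) t :: real)\<^sup>2)"
    by (simp add: integral_indicator_dyadic_cell)
qed (use assms in \<open>auto simp: half_line_L2_cont_def\<close>)

lemma haar_lincomb:
  assumes f: "half_line_L2_cont f" and h: "half_line_L2_cont h"
  shows "haar n (\<lambda>t. f t + c * h t) = haar n f + c * haar n h"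
proof -
  have "cell_integral j k (\<lambda>t. f t + c * h t) = cell_integral j k f + c * cell_integral j k h" for j k
  proof -
    have "cell_integral j k (\<lambda>t. f t + c * h t) =
      (LINT t|lborel. indicator (dyadic_cell j k) t * f t + c * (indicator (dyadic_cell j k) t * h t))"
      unfolding cell_integral_def by (intro Bochner_Integration.integral_cong) (auto simp: algebra_simps)
    also have "\<dots> = cell_integral j k f + c * cell_integral j k h"
      unfolding cell_integral_def using cell_integrable[OF f] cell_integrable[OF h] by simp
    finally show ?thesis .
  qed
  then have "haar_pair i k (\<lambda>t. f t + c * h t) = haar_pair i k f + c * haar_pair i k h" for i k
    by (cases i) (simp_all add: algebra_simps)
  then show ?thesis by (simp add: haar_def)
qed

lemma cell_integral_split:
  assumes "half_line_L2_cont f"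
  shows "cell_integral j k f = cell_integral (Suc j) (2 * k) f + cell_integral (Suc j) (Suc (2 * k)) f"
  unfolding cell_integral_def indicator_dyadic_cell_split[of j k] distrib_right
  using assms by (intro Bochner_Integration.integral_add cell_integrable)

lemma cell_integral_square_le:
  assumes f: "half_line_L2_cont f"
  shows "2 ^ j * (cell_integral j k f)\<^sup>2 \<le> (LINT t|lborel. indicator (dyadic_cell j k) t * (f t)\<^sup>2)"
proof -
  have [measurable]: "f \<in> borel_measurable borel" using f by (auto simp: half_line_L2_cont_def)
  \<comment> \<open>The mean of \<open>f\<close> over the cell; the claim is that the variance there
    is nonnegative.\<close>
  define m where "m = 2 ^ j * cell_integral j k f"
  let ?I = "indicator (dyadic_cell j k) :: real \<Rightarrow> real"
  have int2: "integrable lborel (\<lambda>t. ?I t * (f t)\<^sup>2)"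
    by (rule Bochner_Integration.integrable_bound[of lborel "\<lambda>t. (f t)\<^sup>2"])
      (use f in \<open>auto simp: half_line_L2_cont_def indicator_def\<close>)
  have "0 \<le> (LINT t|lborel. ?I t * (f t - m)\<^sup>2)" by simp
  also have "\<dots> = (LINT t|lborel. ?I t * (f t)\<^sup>2 - (2 * m) * (?I t * f t) + m\<^sup>2 * ?I t)"
    by (intro Bochner_Integration.integral_cong) (auto simp: power2_eq_square algebra_simps)
  also have "\<dots> = (LINT t|lborel. ?I t * (f t)\<^sup>2) - 2 * m * cell_integral j k f + m\<^sup>2 * (1 / 2 ^ j)"
    unfolding cell_integral_def using int2 cell_integrable[OF f, of j k] integral_indicator_dyadic_cell[of j k] by simp
  also have "\<dots> = (LINT t|lborel. ?I t * (f t)\<^sup>2) - 2 ^ j * (cell_integral j k f)\<^sup>2"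
    by (simp add: m_def power2_eq_square field_simps)
  finally show ?thesis by simp
qed

text \<open>The cell containing \<open>t\<close> has length 2^(-j), so continuity at
  \<open>t\<close> eventually controls \<open>f\<close> on the whole cell.\<close>

lemma cell_average_tendsto:
  assumes f: "half_line_L2_cont f" and t: "0 < t"
  shows "(\<lambda>j. 2 ^ j * cell_integral j (nat \<lfloor>t * 2 ^ j\<rfloor>) f) \<longlonglongrightarrow> f t"
proof (rule LIMSEQ_I)
  fix e :: real assume e: "0 < e"
  have "isCont f t" using f t by (simp add: half_line_L2_cont_def)
  then obtain d where d: "0 < d" "\<And>s. \<bar>s - t\<bar> < d \<Longrightarrow> \<bar>f s - f t\<bar> < e / 2"
    using e unfolding continuous_at_eps_delta dist_real_def by (metis half_gt_zero)
  have "(\<lambda>j. (1 / 2) ^ j) \<longlonglongrightarrow> (0::real)" by (intro LIMSEQ_power_zero) auto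
  then have "\<forall>\<^sub>F j in sequentially. (1 / 2) ^ j < d" using d(1) by (rule order_tendstoD)
  then obtain N where N: "\<And>j. N \<le> j \<Longrightarrow> (1 / 2) ^ j < d" by (auto simp: eventually_sequentially)
  show "\<exists>N. \<forall>j\<ge>N. norm (2 ^ j * cell_integral j (nat \<lfloor>t * 2 ^ j\<rfloor>) f - f t) < e"
  proof (intro exI allI impI)
    fix j assume "N \<le> j"
    then have j: "1 / 2 ^ j < d" using N[of j] by (simp add: power_one_over)
    define k where "k = nat \<lfloor>t * 2 ^ j\<rfloor>"
    let ?I = "indicator (dyadic_cell j k) :: real \<Rightarrow> real"
    have tk: "t \<in> dyadic_cell j k" using t by (simp add: dyadic_cell_iff k_def)
    have close: "\<bar>f s - f t\<bar> < e / 2" if "s \<in> dyadic_cell j k" for s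
    proof (rule d(2))
      have "\<bar>s - t\<bar> < 1 / 2 ^ j"
        using that tk unfolding dyadic_cell_def by (auto simp: abs_if add_divide_distrib)
      then show "\<bar>s - t\<bar> < d" using j by simp
    qed
    have "cell_integral j k f - f t * (1 / 2 ^ j) = (LINT s|lborel. ?I s * f s - f t * ?I s)"
      unfolding cell_integral_def using cell_integrable[OF f, of j k] integral_indicator_dyadic_cell[of j k] by simp
    also have "norm \<dots> \<le> (LINT s|lborel. (e / 2) * ?I s)"
    proof (rule norm_integral_le_dominated)
      show "integrable lborel (\<lambda>s. (e / 2) * ?I s)" by (intro integrable_mult_right integral_indicator_dyadic_cell)
      show "norm (?I s * f s - f t * ?I s) \<le> (e / 2) * ?I s" for s
        using close[of s] by (cases "s \<in> dyadic_cell j k") auto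
    qed
    also have "\<dots> = (e / 2) * (1 / 2 ^ j)" by simp
    finally have "2 ^ j * \<bar>cell_integral j k f - f t * (1 / 2 ^ j)\<bar> \<le> e / 2" by (simp add: field_simps)
    also have "2 ^ j * \<bar>cell_integral j k f - f t * (1 / 2 ^ j)\<bar> = \<bar>2 ^ j * (cell_integral j k f - f t * (1 / 2 ^ j))\<bar>"
      by (simp add: abs_mult)
    also have "2 ^ j * (cell_integral j k f - f t * (1 / 2 ^ j)) = 2 ^ j * cell_integral j k f - f t"
      by (simp add: right_diff_distrib)
    finally show "norm (2 ^ j * cell_integral j (nat \<lfloor>t * 2 ^ j\<rfloor>) f - f t) < e"
      using e unfolding k_def by simp
  qed
qed

lemma suminf_ennreal_even_odd:
  fixes h :: "nat \<Rightarrow> ennreal"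
  shows "(\<Sum>k. h k) = (\<Sum>k. h (2 * k) + h (Suc (2 * k)))"
proof -
  have "(\<Sum>k<n. h (2 * k) + h (Suc (2 * k))) = (\<Sum>k<2 * n. h k)" for n
    by (induction n) (auto simp: add.assoc)
  moreover have "(\<lambda>n. \<Sum>k<2 * n. h k) \<longlonglongrightarrow> (\<Sum>k. h k)"
    using LIMSEQ_subseq_LIMSEQ[OF summable_LIMSEQ[OF summableI, of h], of "\<lambda>n. 2 * n"]
    by (auto simp: o_def strict_mono_def)
  ultimately have "(\<lambda>k. h (2 * k) + h (Suc (2 * k))) sums (\<Sum>k. h k)" by (simp add: sums_def)
  then show ?thesis by (simp add: sums_iff)
qed

text \<open>\<open>E j\<close> is the squared norm of the projection of \<open>f\<close> to step
  functions on the cells of level \<open>j\<close>, and the wavelet coefficients account for its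
  increments. It never exceeds the squared norm of \<open>f\<close>, and by Fatou's lemma its limit
  is not smaller. Extended nonnegative reals let the double series be rearranged freely.\<close>

lemma haar_parseval:
  assumes f: "half_line_L2_cont f"
  shows "(\<lambda>n. (haar n f)\<^sup>2) sums (LINT t|lborel. (f t)\<^sup>2)"
proof -
  have [measurable]: "f \<in> borel_measurable borel" and f2: "integrable lborel (\<lambda>t. (f t)\<^sup>2)"
    and f0: "\<And>t. t \<le> 0 \<Longrightarrow> f t = 0"
    using f by (auto simp: half_line_L2_cont_def)
  define E where "E j = (\<Sum>k. ennreal (2 ^ j * (cell_integral j k f)\<^sup>2))" for j
  define N where "N = (\<integral>\<^sup>+t. ennreal ((f t)\<^sup>2) \<partial>lborel)"
  have E_Suc: "E (Suc j) = E j + (\<Sum>k. ennreal ((haar_pair (Suc j) k f)\<^sup>2))" for j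
  proof -
    let ?c = "\<lambda>k. cell_integral (Suc j) k f"
    have "E (Suc j) = (\<Sum>k. ennreal (2 ^ Suc j * (?c (2 * k))\<^sup>2) + ennreal (2 ^ Suc j * (?c (Suc (2 * k)))\<^sup>2))"
      unfolding E_def by (rule suminf_ennreal_even_odd)
    also have "\<dots> = (\<Sum>k. ennreal (2 ^ j * (cell_integral j k f)\<^sup>2) + ennreal ((haar_pair (Suc j) k f)\<^sup>2))"
    proof (rule arg_cong[where f = suminf], rule ext)
      fix k
      \<comment> \<open>The parallelogram law for the integrals over the two halves of a
        cell.\<close>
      have "2 ^ Suc j * (?c (2 * k))\<^sup>2 + 2 ^ Suc j * (?c (Suc (2 * k)))\<^sup>2
          = 2 ^ j * (cell_integral j k f)\<^sup>2 + (haar_pair (Suc j) k f)\<^sup>2"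
        unfolding cell_integral_split[OF f, of j k] haar_pair.simps
        by (simp add: power_mult_distrib) (simp add: power2_eq_square algebra_simps)
      then show "ennreal (2 ^ Suc j * (?c (2 * k))\<^sup>2) + ennreal (2 ^ Suc j * (?c (Suc (2 * k)))\<^sup>2)
          = ennreal (2 ^ j * (cell_integral j k f)\<^sup>2) + ennreal ((haar_pair (Suc j) k f)\<^sup>2)"
        by (simp flip: ennreal_plus del: haar_pair.simps power_Suc)
    qed
    also have "\<dots> = E j + (\<Sum>k. ennreal ((haar_pair (Suc j) k f)\<^sup>2))"
      unfolding E_def by (rule suminf_add[symmetric]) auto
    finally show ?thesis .
  qed
  have E_eq: "E j = (\<Sum>i<Suc j. \<Sum>k. ennreal ((haar_pair i k f)\<^sup>2))" for j
  proof (induction j)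
    case 0
    then show ?case by (simp add: E_def)
  next
    case (Suc j)
    then show ?case by (simp add: E_Suc del: haar_pair.simps)
  qed
  have E_le: "E j \<le> N" for j
  proof -
    have "E j \<le> (\<Sum>k. \<integral>\<^sup>+t. ennreal ((f t)\<^sup>2) * indicator (dyadic_cell j k) t \<partial>lborel)"
      unfolding E_def
    proof (intro suminf_le summableI)
      fix k
      have int2: "integrable lborel (\<lambda>t. indicator (dyadic_cell j k) t * (f t)\<^sup>2)"
        by (rule Bochner_Integration.integrable_bound[OF f2]) (auto simp: indicator_def)
      have "ennreal (2 ^ j * (cell_integral j k f)\<^sup>2) \<le> ennreal (LINT t|lborel. indicator (dyadic_cell j k) t * (f t)\<^sup>2)"
        by (intro ennreal_leI cell_integral_square_le f)
      also have "\<dots> = (\<integral>\<^sup>+t. ennreal (indicator (dyadic_cell j k) t * (f t)\<^sup>2) \<partial>lborel)"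
        by (rule nn_integral_eq_integral[OF int2, symmetric]) auto
      also have "\<dots> = (\<integral>\<^sup>+t. ennreal ((f t)\<^sup>2) * indicator (dyadic_cell j k) t \<partial>lborel)"
        by (intro nn_integral_cong) (auto simp: indicator_def)
      finally show "ennreal (2 ^ j * (cell_integral j k f)\<^sup>2) \<le> (\<integral>\<^sup>+t. ennreal ((f t)\<^sup>2) * indicator (dyadic_cell j k) t \<partial>lborel)" .
    qed
    also have "\<dots> = (\<integral>\<^sup>+t. (\<Sum>k. ennreal ((f t)\<^sup>2) * indicator (dyadic_cell j k) t) \<partial>lborel)"
      by (rule nn_integral_suminf[symmetric]) measurable
    also have "\<dots> = (\<integral>\<^sup>+t. ennreal ((f t)\<^sup>2) * indicator {0..} t \<partial>lborel)"
      by (simp add: suminf_indicator[OF disjoint_dyadic_cell] UN_dyadic_cell)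
    also have "\<dots> \<le> N"
      unfolding N_def by (intro nn_integral_mono) (auto simp: indicator_def)
    finally show ?thesis .
  qed
  have le_E: "N \<le> liminf E"
  proof -
    \<comment> \<open>The square of the step function of cell averages: its integral is
      \<open>E j\<close>, and for t > 0 it converges to \<open>(f t)\<^sup>2\<close>.\<close>
    define P where "P j t = (\<Sum>k. ennreal ((2 ^ j * cell_integral j k f)\<^sup>2) * indicator (dyadic_cell j k) t)" for j t
    have P_meas: "P j \<in> borel_measurable lborel" for j
      unfolding P_def by measurable
    have P_int: "(\<integral>\<^sup>+t. P j t \<partial>lborel) = E j" for j
    proof -
      have "(\<integral>\<^sup>+t. P j t \<partial>lborel) = (\<Sum>k. \<integral>\<^sup>+t. ennreal ((2 ^ j * cell_integral j k f)\<^sup>2) * indicator (dyadic_cell j k) t \<partial>lborel)"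
        unfolding P_def by (rule nn_integral_suminf) measurable
      also have "\<dots> = (\<Sum>k. ennreal ((2 ^ j * cell_integral j k f)\<^sup>2) * ennreal (1 / 2 ^ j))"
        by (simp add: nn_integral_cmult_indicator emeasure_dyadic_cell)
      also have "\<dots> = E j"
        unfolding E_def
      proof (intro arg_cong[where f = suminf] ext)
        fix k
        have "ennreal ((2 ^ j * cell_integral j k f)\<^sup>2) * ennreal (1 / 2 ^ j)
            = ennreal ((2 ^ j * cell_integral j k f)\<^sup>2 * (1 / 2 ^ j))"
          by (rule ennreal_mult[symmetric]) auto
        also have "(2 ^ j * cell_integral j k f)\<^sup>2 * (1 / 2 ^ j) = 2 ^ j * (cell_integral j k f)\<^sup>2"
          by (simp add: power2_eq_square)
        finally show "ennreal ((2 ^ j * cell_integral j k f)\<^sup>2) * ennreal (1 / 2 ^ j)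
            = ennreal (2 ^ j * (cell_integral j k f)\<^sup>2)" .
      qed
      finally show ?thesis .
    qed
    have P_val: "P j t = ennreal ((2 ^ j * cell_integral j (nat \<lfloor>t * 2 ^ j\<rfloor>) f)\<^sup>2)" if "0 < t" for j t
      unfolding P_def
      by (rule suminf_cmult_indicator[OF disjoint_dyadic_cell]) (use that in \<open>auto simp: dyadic_cell_iff\<close>)
    have pw: "ennreal ((f t)\<^sup>2) \<le> liminf (\<lambda>j. P j t)" for t
    proof (cases "0 < t")
      case True
      have "(\<lambda>j. P j t) \<longlonglongrightarrow> ennreal ((f t)\<^sup>2)"
        unfolding P_val[OF True] by (intro tendsto_ennrealI tendsto_power cell_average_tendsto f True)
      then show ?thesis by (simp add: lim_imp_Liminf)
    qed (simp add: f0)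
    have "N \<le> (\<integral>\<^sup>+t. liminf (\<lambda>j. P j t) \<partial>lborel)"
      unfolding N_def by (intro nn_integral_mono pw)
    also have "\<dots> \<le> liminf (\<lambda>j. \<integral>\<^sup>+t. P j t \<partial>lborel)"
      by (intro nn_integral_liminf P_meas)
    finally show ?thesis by (simp add: P_int)
  qed
  have "(\<lambda>j. \<Sum>i<Suc j. \<Sum>k. ennreal ((haar_pair i k f)\<^sup>2)) \<longlonglongrightarrow> (\<Sum>i. \<Sum>k. ennreal ((haar_pair i k f)\<^sup>2))"
    by (rule LIMSEQ_Suc[OF summable_LIMSEQ[OF summableI]])
  then have lim: "E \<longlonglongrightarrow> (\<Sum>i. \<Sum>k. ennreal ((haar_pair i k f)\<^sup>2))"
    by (simp only: E_eq[symmetric])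
  have "(\<Sum>i. \<Sum>k. ennreal ((haar_pair i k f)\<^sup>2)) = N"
  proof (rule antisym)
    show "(\<Sum>i. \<Sum>k. ennreal ((haar_pair i k f)\<^sup>2)) \<le> N"
      using E_le by (intro LIMSEQ_le_const2[OF lim]) auto
    show "N \<le> (\<Sum>i. \<Sum>k. ennreal ((haar_pair i k f)\<^sup>2))"
      using le_E unfolding lim_imp_Liminf[OF sequentially_bot lim] .
  qed
  moreover have "(\<Sum>n. ennreal ((haar n f)\<^sup>2)) = (\<Sum>i. \<Sum>k. ennreal ((haar_pair i k f)\<^sup>2))"
    unfolding haar_def
    by (rule suminf_ennreal_2dimen[where f = "\<lambda>p. ennreal ((haar_pair (fst p) (snd p) f)\<^sup>2)"]) (simp del: haar_pair.simps)
  moreover have "N = ennreal (LINT t|lborel. (f t)\<^sup>2)"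
    unfolding N_def by (rule nn_integral_eq_integral[OF f2]) auto
  ultimately have "(\<lambda>n. ennreal ((haar n f)\<^sup>2)) sums ennreal (LINT t|lborel. (f t)\<^sup>2)"
    using summable_sums[OF summableI, of "\<lambda>n. ennreal ((haar n f)\<^sup>2)"] by simp
  then show ?thesis by simp
qed

text \<open>Polarization: a quarter of the difference of Parseval's identity for f + h and f -
  h.\<close>

lemma haar_parseval_inner:
  assumes f: "half_line_L2_cont f" and h: "half_line_L2_cont h"
  shows "(\<lambda>n. haar n f * haar n h) sums (LINT t|lborel. f t * h t)"
proof -
  have [measurable]: "f \<in> borel_measurable borel" "h \<in> borel_measurable borel"
    and f2: "integrable lborel (\<lambda>t. (f t)\<^sup>2)" and h2: "integrable lborel (\<lambda>t. (h t)\<^sup>2)"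
    using f h by (auto simp: half_line_L2_cont_def)
  have fh: "integrable lborel (\<lambda>t. f t * h t)"
    using f2 h2 by (intro integrable_mult_of_square_integrable) auto
  have "(\<lambda>n. (haar n f + c * haar n h)\<^sup>2) sums (LINT t|lborel. (f t + c * h t)\<^sup>2)" for c
    using haar_parseval[OF half_line_L2_cont_lincomb[OF f h, of c]] by (simp add: haar_lincomb[OF f h])
  from sums_divide[OF sums_diff[OF this[of 1] this[of "-1"]], of 4]
  have "(\<lambda>n. haar n f * haar n h) sums (((LINT t|lborel. (f t + 1 * h t)\<^sup>2) - (LINT t|lborel. (f t + (-1) * h t)\<^sup>2)) / 4)"
    by (simp add: power2_eq_square algebra_simps)
  also have "((LINT t|lborel. (f t + 1 * h t)\<^sup>2) - (LINT t|lborel. (f t + (-1) * h t)\<^sup>2)) / 4 = (LINT t|lborel. f t * h t)"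
    using f2 h2 fh by (simp add: power2_sum power2_diff mult.assoc)
  finally show ?thesis .
qed

section \<open>Squares of Hankel operators\<close>

text \<open>The integral takes values in [0, \<infinity>], so the bound includes finiteness; a
  Bochner integral would be 0 by convention in the divergent case.\<close>

locale hankel_symbol =
  fixes A :: "real \<Rightarrow> real"
  assumes contA: "continuous_on {0<..} A"
    and intA: "(\<integral>\<^sup>+ u. ennreal (indicator {0<..} u * (u * (A u)\<^sup>2)) \<partial>lborel) \<le> 1"
begin

text \<open>Extension by 0 makes the kernel \<open>W0\<close> vanish off the open quadrant, whatever
  values \<open>A\<close> takes outside its domain, and lets all integrals run over the
  line.\<close>

definition F :: "real \<Rightarrow> real \<Rightarrow> real" where
  "F u t = (if 0 < u \<and> 0 < t then A (u + t) else 0)"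

definition W0 :: "real \<Rightarrow> real \<Rightarrow> real" where
  "W0 u v = (LINT t|lborel. F u t * F v t)"

definition weight :: "real \<Rightarrow> real" where
  "weight u = sqrt (W0 u u)"

lemma A_measurable: "(\<lambda>x. if 0 < x then A x else 0) \<in> borel_measurable borel"
proof -
  have "(\<lambda>x. indicator {0<..} x *\<^sub>R A x) \<in> borel_measurable borel"
    by (rule borel_measurable_continuous_on_indicator[OF _ contA]) simp
  also have "(\<lambda>x. indicator {0<..} x *\<^sub>R A x) = (\<lambda>x. if 0 < x then A x else 0)" by auto
  finally show ?thesis .
qed

lemma F_measurable [measurable (raw)]:
  assumes [measurable]: "f \<in> borel_measurable N" "h \<in> borel_measurable N"
  shows "(\<lambda>x. F (f x) (h x)) \<in> borel_measurable N"
proof -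
  have "(\<lambda>x. (\<lambda>x. if 0 < x then A x else 0) (f x + h x)) \<in> borel_measurable N"
    by (rule measurable_compose[OF _ A_measurable]) measurable
  then have [measurable]: "(\<lambda>x. if 0 < f x + h x then A (f x + h x) else 0) \<in> borel_measurable N" .
  have "(\<lambda>x. F (f x) (h x)) = (\<lambda>x. if 0 < f x \<and> 0 < h x then if 0 < f x + h x then A (f x + h x) else 0 else 0)"
    by (auto simp: F_def fun_eq_iff)
  also have "\<dots> \<in> borel_measurable N" by measurable
  finally show ?thesis .
qed

lemma nn_integral_F: "(\<integral>\<^sup>+t. ennreal ((F u t)\<^sup>2) \<partial>lborel) = (\<integral>\<^sup>+x. ennreal (if 0 < u \<and> u < x then (A x)\<^sup>2 else 0) \<partial>lborel)"
proof -
  have [measurable]: "(\<lambda>x. F u (x - u)) \<in> borel_measurable borel" by measurable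
  have "(\<integral>\<^sup>+x. ennreal (if 0 < u \<and> u < x then (A x)\<^sup>2 else 0) \<partial>lborel) = (\<integral>\<^sup>+x. ennreal ((F u (x - u))\<^sup>2) \<partial>lborel)"
    by (intro nn_integral_cong) (auto simp: F_def)
  also have "\<dots> = (\<integral>\<^sup>+t. ennreal ((F u t)\<^sup>2) \<partial>lborel)"
    by (subst nn_integral_real_affine[where c = 1 and t = u]) auto
  finally show ?thesis by simp
qed

text \<open>Markov's inequality: the weight exceeds \<open>c\<close> on the tail. It yields square
  integrability of each \<open>F u\<close> and, later, a tail bound uniform in
  \<open>u\<close>.\<close>

lemma tail_le:
  assumes "0 < c"
  shows "(\<integral>\<^sup>+x. ennreal (if c < x then (A x)\<^sup>2 else 0) \<partial>lborel) \<le> ennreal (1 / c)"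
proof -
  have [measurable]: "(\<lambda>x. if 0 < x then A x else 0) \<in> borel_measurable borel" by (rule A_measurable)
  have "(\<lambda>u. ennreal (indicator {0<..} u * (u * (A u)\<^sup>2))) = (\<lambda>u. ennreal (u * (if 0 < u then A u else 0)\<^sup>2))"
    by (auto simp: indicator_def)
  then have [measurable]: "(\<lambda>u. ennreal (indicator {0<..} u * (u * (A u)\<^sup>2))) \<in> borel_measurable lborel" by simp
  have "(\<integral>\<^sup>+x. ennreal (if c < x then (A x)\<^sup>2 else 0) \<partial>lborel)
    \<le> (\<integral>\<^sup>+x. ennreal (1 / c) * ennreal (indicator {0<..} x * (x * (A x)\<^sup>2)) \<partial>lborel)"
  proof (rule nn_integral_mono)
    fix x
    have "c * (A x)\<^sup>2 \<le> x * (A x)\<^sup>2" if "c < x" using that by (intro mult_right_mono) auto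
    then have "(if c < x then (A x)\<^sup>2 else 0) \<le> (1 / c) * (indicator {0<..} x * (x * (A x)\<^sup>2))"
      using assms by (auto simp: indicator_def field_simps)
    then show "ennreal (if c < x then (A x)\<^sup>2 else 0) \<le> ennreal (1 / c) * ennreal (indicator {0<..} x * (x * (A x)\<^sup>2))"
      using assms by (simp add: ennreal_leI indicator_def flip: ennreal_mult)
  qed
  also have "\<dots> = ennreal (1 / c) * (\<integral>\<^sup>+x. ennreal (indicator {0<..} x * (x * (A x)\<^sup>2)) \<partial>lborel)"
    by (rule nn_integral_cmult) measurable
  also have "\<dots> \<le> ennreal (1 / c) * 1" by (intro mult_left_mono intA) auto
  finally show ?thesis by simp
qed

lemma F_square_integrable: "integrable lborel (\<lambda>t. (F u t)\<^sup>2)"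
proof (rule integrableI_bounded)
  have "(\<integral>\<^sup>+t. ennreal ((F u t)\<^sup>2) \<partial>lborel) < \<infinity>"
  proof (cases "0 < u")
    case True
    then show ?thesis unfolding nn_integral_F using tail_le[OF True] by (simp add: le_less_trans)
  qed (simp add: F_def)
  then show "(\<integral>\<^sup>+t. ennreal (norm ((F u t)\<^sup>2)) \<partial>lborel) < \<infinity>" by simp
qed measurable

lemma F_half_line_L2_cont: "half_line_L2_cont (F u)"
  unfolding half_line_L2_cont_def
proof (intro conjI allI impI)
  show "integrable lborel (\<lambda>t. (F u t)\<^sup>2)" by (rule F_square_integrable)
  show "F u \<in> borel_measurable borel" by (rule F_measurable[of "\<lambda>_. u" borel "\<lambda>x. x"]) measurable
  show "F u t = 0" if "t \<le> 0" for t using that by (simp add: F_def)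
  show "isCont (F u) t" if t: "0 < t" for t
  proof (cases "0 < u")
    case True
    have "continuous_on {0<..} (\<lambda>t. A (u + t))"
      using True by (intro continuous_on_compose2[OF contA] continuous_intros) auto
    then have "continuous_on {0<..} (F u)"
      by (rule continuous_on_eq) (use True in \<open>auto simp: F_def\<close>)
    then show ?thesis using t by (simp add: continuous_on_eq_continuous_at)
  next
    case False
    then have "F u = (\<lambda>t. 0)" by (auto simp: F_def)
    then show ?thesis by simp
  qed
qed

lemma F_mult_integrable: "integrable lborel (\<lambda>t. F u t * F v t)"
  by (rule integrable_mult_of_square_integrable[OF _ _ F_square_integrable F_square_integrable]) measurable

lemma W0_diagonal: "W0 u u = (LINT t|lborel. (F u t)\<^sup>2)"
  by (simp add: W0_def power2_eq_square)

lemma weight_square: "(weight u)\<^sup>2 = W0 u u"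
  by (simp add: weight_def W0_diagonal)

lemma W0_le: "\<bar>W0 u v\<bar> \<le> weight u * weight v"
  unfolding weight_def W0_diagonal unfolding W0_def
  by (rule Cauchy_Schwarz_integral[OF _ _ F_square_integrable F_square_integrable]) measurable

lemma W0_measurable [measurable (raw)]:
  assumes [measurable]: "f \<in> borel_measurable N" "h \<in> borel_measurable N"
  shows "(\<lambda>x. W0 (f x) (h x)) \<in> borel_measurable N"
  unfolding W0_def by measurable

lemma weight_nn_integral: "(\<integral>\<^sup>+u. ennreal ((weight u)\<^sup>2) \<partial>lborel) \<le> 1"
proof -
  have [measurable]: "(\<lambda>x. if 0 < x then A x else 0) \<in> borel_measurable borel" by (rule A_measurable)
  define f where "f u x = ennreal (if 0 < u \<and> u < x then (if 0 < x then A x else 0)\<^sup>2 else 0)" for u x :: real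
  have [measurable]: "(\<lambda>(u, x). f u x) \<in> borel_measurable (lborel \<Otimes>\<^sub>M lborel)"
    unfolding f_def by measurable
  have "(\<integral>\<^sup>+u. ennreal ((weight u)\<^sup>2) \<partial>lborel) = (\<integral>\<^sup>+u. \<integral>\<^sup>+x. f u x \<partial>lborel \<partial>lborel)"
  proof (rule nn_integral_cong)
    fix u
    have "ennreal ((weight u)\<^sup>2) = (\<integral>\<^sup>+t. ennreal ((F u t)\<^sup>2) \<partial>lborel)"
      unfolding weight_square W0_diagonal
      by (rule nn_integral_eq_integral[OF F_square_integrable, symmetric]) auto
    also have "\<dots> = (\<integral>\<^sup>+x. f u x \<partial>lborel)"
      unfolding nn_integral_F f_def by (intro nn_integral_cong) auto
    finally show "ennreal ((weight u)\<^sup>2) = (\<integral>\<^sup>+x. f u x \<partial>lborel)" .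
  qed
  also have "\<dots> = (\<integral>\<^sup>+x. \<integral>\<^sup>+u. f u x \<partial>lborel \<partial>lborel)"
    by (rule lborel_pair.Fubini') measurable
  \<comment> \<open>For fixed \<open>x\<close> the variable \<open>u\<close> runs through (0, x),
    whose length supplies the weight \<open>x\<close>.\<close>
  also have "\<dots> = (\<integral>\<^sup>+x. ennreal (indicator {0<..} x * (x * (A x)\<^sup>2)) \<partial>lborel)"
  proof (rule nn_integral_cong)
    fix x :: real
    have "(\<integral>\<^sup>+u. f u x \<partial>lborel) = (\<integral>\<^sup>+u. ennreal ((A x)\<^sup>2) * indicator {0<..<x} u \<partial>lborel)"
      unfolding f_def by (intro nn_integral_cong) (auto simp: indicator_def)
    also have "\<dots> = ennreal ((A x)\<^sup>2) * emeasure lborel {0<..<x}"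
      by (rule nn_integral_cmult_indicator) simp
    also have "\<dots> = ennreal (indicator {0<..} x * (x * (A x)\<^sup>2))"
    proof (cases "0 < x")
      case True
      then show ?thesis by (simp add: mult.commute flip: ennreal_mult)
    qed simp
    finally show "(\<integral>\<^sup>+u. f u x \<partial>lborel) = ennreal (indicator {0<..} x * (x * (A x)\<^sup>2))" .
  qed
  also note intA
  finally show ?thesis .
qed

lemma weight_measurable: "weight \<in> borel_measurable borel"
  unfolding weight_def by measurable

lemma weight_integrable: "integrable lborel (\<lambda>u. (weight u)\<^sup>2)"
  using le_less_trans[OF weight_nn_integral, of \<infinity>] weight_measurable
  by (intro integrableI_bounded) auto

lemma weight_mass: "(LINT u|lborel. (weight u)\<^sup>2) \<le> 1"
proof -
  have "ennreal (LINT u|lborel. (weight u)\<^sup>2) \<le> ennreal 1"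
    using weight_nn_integral nn_integral_eq_integral[OF weight_integrable] by simp
  then show ?thesis by (subst (asm) ennreal_le_iff) auto
qed

text \<open>For t > N the function \<open>F u\<close> sees \<open>A\<close> only beyond
  \<open>N\<close>, whatever \<open>u\<close> is. Hence the bound does not involve \<open>u\<close>
  and \<open>v\<close>.\<close>

lemma W0_tail_le:
  assumes "0 < N"
  shows "\<bar>LINT t|lborel. (if N < t then F u t * F v t else 0)\<bar> \<le> 1 / N"
proof -
  have tail: "(LINT t|lborel. (if N < t then F u t else 0)\<^sup>2) \<le> 1 / N"
    and int: "integrable lborel (\<lambda>t. (if N < t then F u t else 0)\<^sup>2)" for u
  proof -
    have "(\<integral>\<^sup>+t. ennreal ((if N < t then F u t else 0)\<^sup>2) \<partial>lborel) \<le> ennreal (1 / N)"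
    proof (cases "0 < u")
      case True
      have "(\<integral>\<^sup>+t. ennreal ((if N < t then F u t else 0)\<^sup>2) \<partial>lborel)
         = (\<integral>\<^sup>+t. ennreal ((if N < (u + 1 * t) - u then F u ((u + 1 * t) - u) else 0)\<^sup>2) \<partial>lborel)" by (simp cong: if_cong)
      also have "\<dots> = (\<integral>\<^sup>+x. ennreal ((if N < x - u then F u (x - u) else 0)\<^sup>2) \<partial>lborel)"
        by (subst (2) nn_integral_real_affine[where c = 1 and t = u]) auto
      also have "\<dots> \<le> (\<integral>\<^sup>+x. ennreal (if N < x then (A x)\<^sup>2 else 0) \<partial>lborel)"
        using True by (intro nn_integral_mono ennreal_leI) (auto simp: F_def)
      also have "\<dots> \<le> ennreal (1 / N)" by (rule tail_le[OF assms])
      finally show ?thesis .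
    qed (simp add: F_def cong: if_cong)
    note le = this
    show int: "integrable lborel (\<lambda>t. (if N < t then F u t else 0)\<^sup>2)"
      by (rule Bochner_Integration.integrable_bound[OF F_square_integrable[of u]]) auto
    have "ennreal (LINT t|lborel. (if N < t then F u t else 0)\<^sup>2) \<le> ennreal (1 / N)"
      using le nn_integral_eq_integral[OF int] by simp
    then show "(LINT t|lborel. (if N < t then F u t else 0)\<^sup>2) \<le> 1 / N"
      using assms by (subst (asm) ennreal_le_iff) auto
  qed
  have eq: "(LINT t|lborel. (if N < t then F u t * F v t else 0))
      = (LINT t|lborel. (if N < t then F u t else 0) * (if N < t then F v t else 0))"
    by (intro Bochner_Integration.integral_cong) auto
  have "\<bar>LINT t|lborel. (if N < t then F u t else 0) * (if N < t then F v t else 0)\<bar> \<le> sqrt (LINT t|lborel. (if N < t then F u t else 0)\<^sup>2) * sqrt (LINT t|lborel. (if N < t then F v t else 0)\<^sup>2)"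
    by (rule Cauchy_Schwarz_integral[OF _ _ int int]) measurable
  also have "\<dots> \<le> sqrt (1 / N) * sqrt (1 / N)"
    by (rule mult_mono[OF real_sqrt_le_mono[OF tail] real_sqrt_le_mono[OF tail]]) (use assms in simp_all)
  also have "\<dots> = 1 / N" using assms by simp
  finally show ?thesis unfolding eq .
qed

text \<open>Integrals over compact intervals depend continuously on the parameters, and the tail
  estimate makes them converge uniformly on the whole open quadrant.\<close>

lemma W0_continuous: "continuous_on ({0<..} \<times> {0<..}) (\<lambda>(u, v). W0 u v)"
proof -
  define T where "T n p = integral (cbox 0 (real (Suc n))) (\<lambda>t. A (fst p + t) * A (snd p + t))" for n and p :: "real \<times> real"
  have T_cont: "continuous_on ({0<..} \<times> {0<..}) (T n)" for n
    unfolding T_def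
  proof (rule integral_continuous_on_param)
    show "continuous_on (({0<..} \<times> {0<..}) \<times> cbox 0 (real (Suc n))) (\<lambda>(p, t). A (fst p + t) * A (snd p + t))"
      unfolding split_beta
      by (intro continuous_on_mult continuous_on_compose2[OF contA] continuous_intros) auto
  qed
  have close: "dist (T n p) (W0 (fst p) (snd p)) \<le> 1 / real (Suc n)" if p: "p \<in> {0<..} \<times> {0<..}" for n p
  proof -
    obtain u v where p_eq: "p = (u, v)" and u: "0 < u" and v: "0 < v" using p by auto
    define N where "N = real (Suc n)"
    have N: "0 < N" by (simp add: N_def)
    have "continuous_on {0..N} (\<lambda>t. A (u + t) * A (v + t))"
      using u v by (intro continuous_on_mult continuous_on_compose2[OF contA] continuous_intros) auto
    then have int: "set_integrable lborel {0..N} (\<lambda>t. A (u + t) * A (v + t))"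
      by (rule borel_integrable_atLeastAtMost')
    have T_eq: "T n p = (LINT t:{0..N}|lborel. A (u + t) * A (v + t))"
      using set_borel_integral_eq_integral(2)[OF int] by (simp add: T_def p_eq N_def)
    have "W0 u v = (LINT t|lborel. indicator {0..N} t *\<^sub>R (A (u + t) * A (v + t)) + (if N < t then F u t * F v t else 0))"
      unfolding W0_def
    proof (rule integral_cong_AE)
      show "AE t in lborel. F u t * F v t = indicator {0..N} t *\<^sub>R (A (u + t) * A (v + t)) + (if N < t then F u t * F v t else 0)"
        \<comment> \<open>At t = 0 the function \<open>F\<close> vanishes by convention while
          \<open>A\<close> need not.\<close>
        using AE_lborel_singleton[of 0] by eventually_elim (use u v N in \<open>auto simp: F_def indicator_def\<close>)
      show "(\<lambda>t. indicator {0..N} t *\<^sub>R (A (u + t) * A (v + t)) + (if N < t then F u t * F v t else 0)) \<in> borel_measurable lborel"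
        using borel_measurable_integrable[OF int[unfolded set_integrable_def]] by measurable
    qed measurable
    also have "\<dots> = (LINT t:{0..N}|lborel. A (u + t) * A (v + t)) + (LINT t|lborel. (if N < t then F u t * F v t else 0))"
      unfolding set_lebesgue_integral_def
    proof (rule Bochner_Integration.integral_add[OF int[unfolded set_integrable_def]])
      show "integrable lborel (\<lambda>t. if N < t then F u t * F v t else 0)"
      proof (rule Bochner_Integration.integrable_bound[OF F_mult_integrable[of u v]])
        show "AE t in lborel. norm (if N < t then F u t * F v t else 0) \<le> norm (F u t * F v t)"
          by (intro always_eventually allI) simp
      qed measurable
    qed
    finally show ?thesis
      using T_eq W0_tail_le[OF N, of u v] by (simp add: dist_real_def p_eq N_def)
  qed
  have "uniform_limit ({0<..} \<times> {0<..}) T (\<lambda>p. W0 (fst p) (snd p)) sequentially"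
  proof (rule uniform_limitI)
    fix e :: real assume "0 < e"
    then have "\<forall>\<^sub>F n in sequentially. 1 / real (Suc n) < e"
      using order_tendstoD(2)[OF LIMSEQ_inverse_real_of_nat] by (simp add: inverse_eq_divide)
    then show "\<forall>\<^sub>F n in sequentially. \<forall>p\<in>{0<..} \<times> {0<..}. dist (T n p) (W0 (fst p) (snd p)) < e"
      by eventually_elim (use close in \<open>meson le_less_trans\<close>)
  qed
  then have "continuous_on ({0<..} \<times> {0<..}) (\<lambda>p. W0 (fst p) (snd p))"
    by (rule uniform_limit_theorem[rotated]) (auto intro: T_cont always_eventually)
  then show ?thesis by (simp add: split_beta)
qed

lemma weight_continuous: "continuous_on {0<..} weight"
proof -
  have "continuous_on {0<..} (\<lambda>u. (\<lambda>(u, v). W0 u v) (u, u))"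
    by (rule continuous_on_compose2[OF W0_continuous]) (auto intro!: continuous_intros)
  then show ?thesis unfolding weight_def by (intro continuous_on_real_sqrt) simp
qed

lemma haar_F_measurable: "(\<lambda>u. haar n (F u)) \<in> borel_measurable borel"
proof -
  have [measurable]: "(\<lambda>u. cell_integral j k (F u)) \<in> borel_measurable borel" for j k
    unfolding cell_integral_def by measurable
  have "(\<lambda>u. haar_pair i k (F u)) \<in> borel_measurable borel" for i k
    by (cases i) simp_all
  then show ?thesis unfolding haar_def .
qed

lemma marchenko_expansion_W0:
  assumes "cmod \<kappa> < 1"
  shows "marchenko_expansion W0 weight \<kappa> (\<lambda>n u. haar n (F u))"
proof
  show "(\<lambda>(u, v). W0 u v) \<in> borel_measurable (borel \<Otimes>\<^sub>M borel)" by measurable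
  show "(\<lambda>n. haar n (F u) * haar n (F v)) sums W0 u v" for u v
    unfolding W0_def by (intro haar_parseval_inner F_half_line_L2_cont)
  show "0 \<le> weight u" for u unfolding weight_def W0_diagonal by simp
  show "W0 u u = (weight u)\<^sup>2" for u by (rule weight_square[symmetric])
qed (use assms in \<open>auto intro: weight_measurable weight_integrable weight_mass W0_le
      weight_continuous W0_continuous haar_F_measurable\<close>)

end

section \<open>Transfer to the given kernel\<close>

lemma trace_class_kernel_cong:
  assumes "\<And>u v. 0 < u \<Longrightarrow> 0 < v \<Longrightarrow> T u v = T' u v" "trace_class_kernel T"
  shows "trace_class_kernel T'"
proof -
  obtain a b where ab: "\<And>n. L2_pos (a n)" "\<And>n. L2_pos (b n)"
      "summable (\<lambda>n. L2_norm_pos (a n) * L2_norm_pos (b n))"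
    and sums: "AE p in lborel. p \<in> {0<..} \<times> {0<..} \<longrightarrow> (\<lambda>n. a n (fst p) * b n (snd p)) sums T (fst p) (snd p)"
    using assms(2) unfolding trace_class_kernel_def by blast
  from sums have "AE p in lborel. p \<in> {0<..} \<times> {0<..} \<longrightarrow> (\<lambda>n. a n (fst p) * b n (snd p)) sums T' (fst p) (snd p)"
    by eventually_elim (auto simp: assms(1))
  with ab show ?thesis unfolding trace_class_kernel_def by blast
qed

text \<open>The determinant is complex-valued, so its logarithmic derivative is expressed without a
  branch of the logarithm: \<open>D x\<close> is nonzero and the derivative of \<open>D\<close> is
  \<open>\<kappa> * K x x * D x\<close>.\<close>

theorem theorem2p3:
  fixes A :: "real \<Rightarrow> real" and W :: "real \<Rightarrow> real \<Rightarrow> real"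
  assumes contA: "continuous_on {0<..} A"
    and intA: "(\<integral>\<^sup>+ u. ennreal (indicator {0<..} u * (u * (A u)^2)) \<partial>lborel) \<le> 1"
    and W_def: "\<And>u v. W u v = (LINT t:{0<..}|lborel. A (u + t) * A (t + v))"
  shows "trace_class_kernel (\<lambda>u v. complex_of_real (W u v)) \<and>
    (\<forall>\<kappa>::complex. cmod \<kappa> < 1 \<longrightarrow>
      (\<exists>K :: real \<Rightarrow> real \<Rightarrow> complex.
         trace_class_kernel K \<and>
         (\<forall>x>0. \<forall>z>0.
             set_integrable lborel {x<..} (\<lambda>y. K x y * complex_of_real (W y z)) \<and>
             K x z - \<kappa>^2 * (LINT y:{x<..}|lborel. K x y * complex_of_real (W y z))
               = \<kappa> * complex_of_real (W x z)) \<and>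
         (\<forall>x>0.
             let D = (\<lambda>s. fredholm_det (\<lambda>y z. - (\<kappa>^2) *
                        (indicator {s<..} y * complex_of_real (W y z) * indicator {s<..} z)))
             in D x \<noteq> 0 \<and> (D has_vector_derivative (\<kappa> * K x x * D x)) (at x))))"
proof -
  interpret H: hankel_symbol A by (unfold_locales; fact)
  \<comment> \<open>Outside the open quadrant \<open>W\<close> may involve values of
    \<open>A\<close> off its domain, and agreement with \<open>H.W0\<close> is not claimed
    there.\<close>
  have W_eq: "W u v = H.W0 u v" if "0 < u" "0 < v" for u v
    unfolding W_def H.W0_def H.F_def set_lebesgue_integral_def using that
    by (intro Bochner_Integration.integral_cong) (auto simp: indicator_def add.commute)
  \<comment> \<open>The statement about \<open>W\<close> does not involve \<kappa>; 0 is simply an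
    admissible value.\<close>
  interpret E0: marchenko_expansion H.W0 H.weight 0 "\<lambda>n u. haar n (H.F u)"
    by (rule H.marchenko_expansion_W0) simp
  have "trace_class_kernel (\<lambda>u v. complex_of_real (W u v))"
    by (rule trace_class_kernel_cong[OF _ E0.trace_class_W]) (simp add: W_eq)
  moreover have "\<exists>K :: real \<Rightarrow> real \<Rightarrow> complex.
         trace_class_kernel K \<and>
         (\<forall>x>0. \<forall>z>0.
             set_integrable lborel {x<..} (\<lambda>y. K x y * complex_of_real (W y z)) \<and>
             K x z - \<kappa>^2 * (LINT y:{x<..}|lborel. K x y * complex_of_real (W y z))
               = \<kappa> * complex_of_real (W x z)) \<and>
         (\<forall>x>0.
             let D = (\<lambda>s. fredholm_det (\<lambda>y z. - (\<kappa>^2) *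
                        (indicator {s<..} y * complex_of_real (W y z) * indicator {s<..} z)))
             in D x \<noteq> 0 \<and> (D has_vector_derivative (\<kappa> * K x x * D x)) (at x))"
    if \<kappa>: "cmod \<kappa> < 1" for \<kappa>
  proof -
    interpret E: marchenko_expansion H.W0 H.weight \<kappa> "\<lambda>n u. haar n (H.F u)"
      by (rule H.marchenko_expansion_W0[OF \<kappa>])
    have restrict: "(\<lambda>y. indicator {x<..} y *\<^sub>R (E.K x y * complex_of_real (W y z)))
        = (\<lambda>y. if x < y then E.K x y * complex_of_real (H.W0 y z) else 0)" if "0 < x" "0 < z" for x z
      using that by (auto simp: indicator_def W_eq)
    define D where "D = (\<lambda>s. fredholm_det (\<lambda>y z. - (\<kappa>^2) *
                        (indicator {s<..} y * complex_of_real (W y z) * indicator {s<..} z)))"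
    \<comment> \<open>For s > 0 the indicators mask all arguments at which \<open>W\<close> and
      \<open>H.W0\<close> could differ, so the two kernels coincide everywhere.\<close>
    have D_eq: "D s = fredholm_det (E.truncated s)" if "0 < s" for s
      unfolding D_def
      by (rule arg_cong[where f = fredholm_det]) (use that in \<open>auto simp: E.truncated_def indicator_def W_eq fun_eq_iff\<close>)
    have D_deriv: "(D has_vector_derivative (\<kappa> * E.K x x * D x)) (at x)" if x: "0 < x" for x
      unfolding D_eq[OF x]
      by (rule has_vector_derivative_transform_within_open[OF E.fredholm_det_truncated_derivative[OF x], of "{0<..}"])
         (use x D_eq in auto)
    show ?thesis
    proof (intro exI[of _ E.K] conjI allI impI)
      show "trace_class_kernel E.K" by (rule E.trace_class_K)
      fix x z :: real assume x: "0 < x" and z: "0 < z"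
      show "set_integrable lborel {x<..} (\<lambda>y. E.K x y * complex_of_real (W y z))"
        unfolding set_integrable_def restrict[OF x z] by (rule E.K_W_integrable)
      show "E.K x z - \<kappa>^2 * (LINT y:{x<..}|lborel. E.K x y * complex_of_real (W y z)) = \<kappa> * complex_of_real (W x z)"
        unfolding set_lebesgue_integral_def restrict[OF x z] W_eq[OF x z] by (rule E.marchenko_equation)
    next
      fix x :: real assume x: "0 < x"
      have "D x \<noteq> 0" using x by (simp add: D_eq E.fredholm_det_truncated_eq_exp_integral)
      then show "let D = (\<lambda>s. fredholm_det (\<lambda>y z. - (\<kappa>^2) *
                        (indicator {s<..} y * complex_of_real (W y z) * indicator {s<..} z)))
             in D x \<noteq> 0 \<and> (D has_vector_derivative (\<kappa> * E.K x x * D x)) (at x)"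
        using D_deriv[OF x] unfolding D_def Let_def by blast
    qed
  qed
  ultimately show ?thesis by blast
qed

end
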